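(* Let $0\le b<a$. For $x\in[a,a/\bar p)$, $$Z^{\uparrow}_b(x,a/\bar p)=\mathrm{diag}\big(e^{-(a/\bar p-x)z_i}\big)_{i\in E}+P(x)\,Z^{\uparrow}_b(a,a/\bar p),$$ where $$Z^{\uparrow}_b(a,a/\bar p)=(I-P(a))^{-1}\,\mathrm{diag}\big(e^{-(a/\bar p-a)z_i}\big)_{i\in E}$$ (in particular $I-P(a)$ is invertible). In particular, knowledge of the upward two-sided transform below $a$ (that is, of $Z^{\uparrow}_b(y,a)$ for all $y<a$) determines it below $a/\bar p$ (that is, determines $Z^{\uparrow}_b(x,a/\bar p)$ for all $x<a/\bar p$).
   Context: Model. Let $E=\{1,\dots,m\}$; for each $i\in E$ let $c_i>0$, $\lambda_i>0$, $p_i\in(0,1)$, and let $Q=(q_{ij})_{i,j\in E}$ be a stochastic matrix; $\bar p=\max_ip_i<1$. $(X,J)$ is the Markov process on $[0,\infty)\times E$ with the following dynamics: while the phase $J$ equals $i$, the level $X$ increases linearly with slope $1/c_i$ and the next jump occurs at rate $\lambda_i$; at a jump from $(x,i)$ the process moves to $(p_i x,j)$ with probability $q_{ij}$ ($j=i$ is allowed). $\mathbb E_{x,i}$ denotes expectation given $(X(0),J(0))=(x,i)$. Fix $w>0$; put $z_i=c_i(\lambda_i+w)$, $\gamma_i=c_i\lambda_i/p_i$. Let $\tau_{\uparrow a}=\inf\{t\ge0:X(t)\ge a\}$ and $\tau_{\downarrow b}=\inf\{t\ge0:X(t)\le b\}$. For $0\le b<a$ the two-sided matrix $Z^{\uparrow}_b(x,a)$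 has entries $$(Z^{\uparrow}_b)_{ij}(x,a)=\mathbb E_{x,i}[e^{-w\tau_{\uparrow a}};\tau_{\uparrow a}<\tau_{\downarrow b},J(\tau_{\uparrow a})=j]$$ (infinite $\tau_{\uparrow a}$ contributes $0$), with the convention $Z^{\uparrow}_b(x,a)=0$ for $x\le b$ and $Z^{\uparrow}_b(x,a)=I$ for $x\ge a$. For $x\in[a,a/\bar p)$ the matrix $P(x)$ has entries $$P_{ij}(x)=\gamma_ie^{z_ix}\int_{p_ix}^{p_ia/\bar p}\sum_{h=1}^mq_{ih}\,(Z^{\uparrow}_b)_{hj}(y,a)\,e^{-(z_i/p_i)y}\,dy .$$ *)

theory Defs
  imports "HOL-Probability.Probability"
begin

locale growth_collapse =
  fixes c lam p :: "'e::finite \<Rightarrow> real" and Q :: "real ^ 'e ^ 'e"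
  assumes c_pos: "\<And>i. 0 < c i"
    and lam_pos: "\<And>i. 0 < lam i"
    and p_pos: "\<And>i. 0 < p i"
    and p_less_1: "\<And>i. p i < 1"
    and Q_nonneg: "\<And>i j. 0 \<le> Q $ i $ j"
    and Q_row_sum: "\<And>i. (\<Sum>j\<in>UNIV. Q $ i $ j) = 1"
begin

definition phase_law :: "'e \<Rightarrow> 'e pmf" where
  "phase_law i = embed_pmf (\<lambda>j. Q $ i $ j)"

lemma pmf_phase_law: "pmf (phase_law i) j = Q $ i $ j"
  unfolding phase_law_def
proof (rule pmf_embed_pmf)
  show "0 \<le> Q $ i $ x" for x by (rule Q_nonneg)
  show "(\<integral>\<^sup>+ x. ennreal (Q $ i $ x) \<partial>count_space UNIV) = 1"
    by (simp add: nn_integral_count_space_finite sum_ennreal Q_nonneg Q_row_sum)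
qed

text \<open>
  The process is built from i.i.d. noise, one item \<open>(e, f)\<close> per jump: \<open>e\<close> is a standard
  exponential variable, and independently \<open>f i\<close> has law \<open>Q $ i\<close> for every phase \<open>i\<close>.
  In phase \<open>i\<close> the time to the next jump is \<open>e / lam i\<close>, which is exponential with rate
  \<open>lam i\<close>, and the phase after the jump is \<open>f i\<close>.
\<close>

definition jump_noise :: "(real \<times> ('e \<Rightarrow> 'e)) measure" where
  "jump_noise = density lborel (\<lambda>t. ennreal (exponential_density 1 t))
     \<Otimes>\<^sub>M measure_pmf (Pi_pmf UNIV undefined phase_law)"

definition noise :: "(real \<times> ('e \<Rightarrow> 'e)) stream measure" where
  "noise = stream_space jump_noise"

text \<open>
  Time of the \<open>n\<close>-th jump, and level and phase immediately after it, for the process started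
  in \<open>(x, i)\<close>; the case \<open>n = 0\<close> is the initial state.
\<close>

primrec skeleton ::
  "real \<Rightarrow> 'e \<Rightarrow> (real \<times> ('e \<Rightarrow> 'e)) stream \<Rightarrow> nat \<Rightarrow> real \<times> real \<times> 'e" where
  "skeleton x i \<omega> 0 = (0, x, i)"
| "skeleton x i \<omega> (Suc n) =
     (case skeleton x i \<omega> n of (s, y, j) \<Rightarrow>
       (let t = fst (\<omega> !! n) / lam j
        in (s + t, p j * (y + t / c j), snd (\<omega> !! n) j)))"

text \<open>
  The number of jumps in \<open>[0, t]\<close>. It is finite almost surely because the jump rates are
  bounded; on the exceptional null set \<open>LEAST\<close> may be unspecified.
\<close>

definition jumps :: "real \<Rightarrow> 'e \<Rightarrow> (real \<times> ('e \<Rightarrow> 'e)) stream \<Rightarrow> real \<Rightarrow> nat" where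
  "jumps x i \<omega> t = (LEAST n. t < fst (skeleton x i \<omega> (Suc n)))"

definition X :: "real \<Rightarrow> 'e \<Rightarrow> (real \<times> ('e \<Rightarrow> 'e)) stream \<Rightarrow> real \<Rightarrow> real" where
  "X x i \<omega> t =
     (case skeleton x i \<omega> (jumps x i \<omega> t) of (s, y, j) \<Rightarrow> y + (t - s) / c j)"

definition J :: "real \<Rightarrow> 'e \<Rightarrow> (real \<times> ('e \<Rightarrow> 'e)) stream \<Rightarrow> real \<Rightarrow> 'e" where
  "J x i \<omega> t = (case skeleton x i \<omega> (jumps x i \<omega> t) of (s, y, j) \<Rightarrow> j)"

definition tau_up :: "real \<Rightarrow> real \<Rightarrow> 'e \<Rightarrow> (real \<times> ('e \<Rightarrow> 'e)) stream \<Rightarrow> ereal" where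
  "tau_up a x i \<omega> = Inf (ereal ` {t. 0 \<le> t \<and> a \<le> X x i \<omega> t})"

definition tau_down :: "real \<Rightarrow> real \<Rightarrow> 'e \<Rightarrow> (real \<times> ('e \<Rightarrow> 'e)) stream \<Rightarrow> ereal" where
  "tau_down b x i \<omega> = Inf (ereal ` {t. 0 \<le> t \<and> X x i \<omega> t \<le> b})"

text \<open>
  An infinite \<open>tau_up\<close> contributes nothing, since it is never less than \<open>tau_down\<close>.
\<close>

definition Zup :: "real \<Rightarrow> real \<Rightarrow> real \<Rightarrow> real \<Rightarrow> real ^ 'e ^ 'e" where
  "Zup w b x a =
     (if x \<le> b then 0
      else if a \<le> x then mat 1
      else (\<chi> i j. \<integral>\<omega>.
        (if tau_up a x i \<omega> < tau_down b x i \<omega> \<and> J x i \<omega> (real_of_ereal (tau_up a x i \<omega>)) = j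
         then exp (- w * real_of_ereal (tau_up a x i \<omega>)) else 0) \<partial>noise))"

definition pbar :: real where
  "pbar = Max (range p)"

definition z :: "real \<Rightarrow> 'e \<Rightarrow> real" where
  "z w i = c i * (lam i + w)"

definition gam :: "'e \<Rightarrow> real" where
  "gam i = c i * lam i / p i"

definition D :: "real \<Rightarrow> real \<Rightarrow> real \<Rightarrow> real ^ 'e ^ 'e" where
  "D w a x = (\<chi> i j. if i = j then exp (- (a / pbar - x) * z w i) else 0)"

text \<open>
  The matrix \<open>P(x)\<close> with an arbitrary matrix-valued function \<open>K\<close> in the place of
  \<open>\<lambda>y. Zup w b y a\<close>, so that it depends on \<open>b\<close> through \<open>K\<close> only.
\<close>

definition P :: "real \<Rightarrow> real \<Rightarrow> (real \<Rightarrow> real ^ 'e ^ 'e) \<Rightarrow> real \<Rightarrow> real ^ 'e ^ 'e" where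
  "P w a K x = (\<chi> i j. gam i * exp (z w i * x) *
     (LBINT y:{p i * x .. p i * a / pbar}.
        (\<Sum>h\<in>UNIV. Q $ i $ h * K y $ h $ j) * exp (- (z w i / p i) * y)))"

text \<open>
  The reconstruction of \<open>\<lambda>x. Zup w b x (a / pbar)\<close> below \<open>a / pbar\<close> from \<open>K\<close> and the
  parameters of the model, when \<open>K y = Zup w b y a\<close> for \<open>y < a\<close>. Below \<open>a\<close>
  it factorises over the first passage at \<open>a\<close>.
\<close>

definition extend :: "real \<Rightarrow> real \<Rightarrow> (real \<Rightarrow> real ^ 'e ^ 'e) \<Rightarrow> real \<Rightarrow> real ^ 'e ^ 'e" where
  "extend w a K x =
     (let R = matrix_inv (mat 1 - P w a K a) ** D w a a
      in if x < a then K x ** R else D w a x + P w a K x ** R)"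

end

end

(*
  Let Z(y, L) be the transform for first passage at L. Conditioning on the first jump, which
  happens at level u with discounted density c_i lam_i e^{-z_i (u - x)}, gives for b < x < L
    Z_ij(x, L) = [i = j] e^{-z_i (L - x)}
               + int_x^L c_i lam_i e^{-z_i (u - x)} sum_h q_ih Z_hj(p_i u, L) du.
  Up to the substitution y = p_i u and the factorisation Z(y, a / pbar) = Z(y, a) Z(a, a / pbar)
  for y < a, this is the first formula, because jumps from below a / pbar land below a. The
  factorisation needs no strong Markov property: both sides satisfy the same first-step equation
  on y < a, whose solution is unique since the total discounted mass of the jump density is at
  most lam_i / (lam_i + w) < 1. The same bound makes the row sums of P(a) less than 1, so that
  I - P(a) is invertible. The jumps do not accumulate because E e^{-S_n} = 2^{-n} for the sum S_n
  of n standard exponential variables.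
*)

theory Submission
  imports Defs
begin

section \<open>Path properties and measurability\<close>

text \<open>Adding a real number preserves order on \<open>ereal\<close>, also when \<open>S\<close>
  is empty and both infima are \<open>\<infinity>\<close>. This moves passage times across the first
  jump.\<close>

lemma Inf_ereal_shift:
  fixes S :: "real set"
  shows "Inf (ereal ` ((+) t ` S)) = ereal t + Inf (ereal ` S)"
proof (rule antisym)
  show "Inf (ereal ` ((+) t ` S)) \<le> ereal t + Inf (ereal ` S)"
  proof -
    have "Inf (ereal ` ((+) t ` S)) - ereal t \<le> Inf (ereal ` S)"
    proof (rule Inf_greatest, clarify)
      fix s assume "s \<in> S"
      then have "Inf (ereal ` ((+) t ` S)) \<le> ereal (t + s)"
        by (intro Inf_lower) auto
      then show "Inf (ereal ` ((+) t ` S)) - ereal t \<le> ereal s"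
        by (simp add: ereal_minus_le_iff add.commute)
    qed
    then show ?thesis
      by (simp add: ereal_minus_le_iff add.commute)
  qed
  show "ereal t + Inf (ereal ` S) \<le> Inf (ereal ` ((+) t ` S))"
  proof (rule Inf_greatest, clarify)
    fix s assume "s \<in> S"
    then have "Inf (ereal ` S) \<le> ereal s"
      by (intro Inf_lower) auto
    then show "ereal t + Inf (ereal ` S) \<le> ereal (t + s)"
      using add_left_mono[of "Inf (ereal ` S)" "ereal s" "ereal t"] by simp
  qed
qed

text \<open>Each point of \<open>S\<close> starts an interval inside \<open>S\<close>, so rational
  points of \<open>S\<close> lie arbitrarily close to its right. The infimum thus becomes countable,
  which is what measurability of \<open>tau_up\<close> requires.\<close>

lemma Inf_ereal_eq_INF_rat:
  fixes S :: "real set"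
  assumes "\<And>s. s \<in> S \<Longrightarrow> \<exists>e>0. {s..<s + e} \<subseteq> S"
  shows "Inf (ereal ` S) = (INF q. if of_rat q \<in> S then ereal (of_rat q) else \<infinity>)"
proof (rule antisym)
  show "Inf (ereal ` S) \<le> (INF q. if of_rat q \<in> S then ereal (of_rat q) else \<infinity>)"
    by (rule INF_greatest) (auto intro: Inf_lower)
  show "(INF q. if of_rat q \<in> S then ereal (of_rat q) else \<infinity>) \<le> Inf (ereal ` S)"
  proof (rule Inf_greatest, clarify)
    fix s assume "s \<in> S"
    then obtain e where e: "e > 0" "{s..<s + e} \<subseteq> S"
      using assms by blast
    show "(INF q. if of_rat q \<in> S then ereal (of_rat q) else \<infinity>) \<le> ereal s"
    proof (rule ereal_le_epsilon2)
      fix d :: real assume "0 < d"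
      then obtain q where q: "s < of_rat q" "of_rat q < s + min d e"
        using of_rat_dense[of s "s + min d e"] e by auto
      then have "of_rat q \<in> S"
        using e by auto
      then have "(INF q. if of_rat q \<in> S then ereal (of_rat q) else \<infinity>) \<le> ereal (of_rat q)"
        by (intro INF_lower2[of q]) auto
      also have "\<dots> \<le> ereal s + ereal d"
        using q by simp
      finally show "(INF q. if of_rat q \<in> S then ereal (of_rat q) else \<infinity>) \<le> ereal s + ereal d" .
    qed
  qed
qed

section \<open>Joint measurability of the path and its passage times\<close>

context growth_collapse
begin

declare skeleton.simps(2) [simp del]

abbreviation jump_time :: "real \<Rightarrow> 'e \<Rightarrow> (real \<times> ('e \<Rightarrow> 'e)) stream \<Rightarrow> nat \<Rightarrow> real" where
  "jump_time x i \<omega> n \<equiv> fst (skeleton x i \<omega> n)"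

abbreviation noise_space :: "(real \<times> ('e \<Rightarrow> 'e)) stream measure" where
  "noise_space \<equiv> stream_space (borel \<Otimes>\<^sub>M count_space UNIV)"

text \<open>Measurability is joint in the initial level and the noise, because the transform is
  later integrated over the level from which it starts.\<close>

lemma measurable_skeleton:
  "(\<lambda>u. skeleton (fst u) i (snd u) n)
     \<in> borel \<Otimes>\<^sub>M noise_space \<rightarrow>\<^sub>M borel \<Otimes>\<^sub>M borel \<Otimes>\<^sub>M count_space UNIV"
proof (induction n)
  case 0
  show ?case by simp
next
  case (Suc n)
  note Suc[measurable]
  let ?s = "\<lambda>u. skeleton (fst u) i (snd u) n" and ?w = "\<lambda>u. snd u !! n"
  have j [measurable]:
    "(\<lambda>u. snd (snd (?s u))) \<in> borel \<Otimes>\<^sub>M noise_space \<rightarrow>\<^sub>M count_space UNIV"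
    by measurable
  have f [measurable]:
    "(\<lambda>u. snd (?w u)) \<in> borel \<Otimes>\<^sub>M noise_space \<rightarrow>\<^sub>M count_space (UNIV :: ('e \<Rightarrow> 'e) set)"
    by measurable
  \<comment> \<open>The random map is evaluated at a random phase; splitting over the finitely many
    values of that phase leaves evaluations at fixed points.\<close>
  have [measurable]:
    "(\<lambda>u. snd (?w u) (snd (snd (?s u)))) \<in> borel \<Otimes>\<^sub>M noise_space \<rightarrow>\<^sub>M count_space UNIV"
    by (rule measurable_compose_countable[OF _ j]) (rule measurable_compose[OF f], simp)
  have [measurable]: "(\<lambda>u. (g :: 'e \<Rightarrow> real) (snd (snd (?s u)))) \<in> borel_measurable (borel \<Otimes>\<^sub>M noise_space)" for g
    by (rule measurable_compose[OF j]) simp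
  have "(\<lambda>u. skeleton (fst u) i (snd u) (Suc n)) =
    (\<lambda>u. (fst (?s u) + fst (?w u) / lam (snd (snd (?s u))),
          p (snd (snd (?s u))) * (fst (snd (?s u)) + fst (?w u) / lam (snd (snd (?s u))) / c (snd (snd (?s u)))),
          snd (?w u) (snd (snd (?s u)))))"
    by (simp add: skeleton.simps(2) Let_def split_beta)
  also have "\<dots> \<in> borel \<Otimes>\<^sub>M noise_space \<rightarrow>\<^sub>M borel \<Otimes>\<^sub>M borel \<Otimes>\<^sub>M count_space UNIV"
    by measurable
  finally show ?case .
qed

lemma measurable_jump_time [measurable]:
  "(\<lambda>u. jump_time (fst u) i (snd u) n) \<in> borel_measurable (borel \<Otimes>\<^sub>M noise_space)"
  using measurable_compose[OF measurable_skeleton measurable_fst] .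

lemma measurable_jumps [measurable (raw)]:
  assumes [measurable]: "g \<in> borel_measurable (borel \<Otimes>\<^sub>M noise_space)"
  shows "(\<lambda>u. jumps (fst u) i (snd u) (g u)) \<in> borel \<Otimes>\<^sub>M noise_space \<rightarrow>\<^sub>M count_space UNIV"
  unfolding jumps_def by measurable

lemma measurable_J [measurable (raw)]:
  assumes [measurable]: "g \<in> borel_measurable (borel \<Otimes>\<^sub>M noise_space)"
  shows "(\<lambda>u. J (fst u) i (snd u) (g u)) \<in> borel \<Otimes>\<^sub>M noise_space \<rightarrow>\<^sub>M count_space UNIV"
proof -
  have "(\<lambda>u. snd (snd (skeleton (fst u) i (snd u) n))) \<in> borel \<Otimes>\<^sub>M noise_space \<rightarrow>\<^sub>M count_space UNIV" for n
    by (rule measurable_compose[OF measurable_skeleton]) simp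
  then show ?thesis
    unfolding J_def split_beta by (rule measurable_compose_countable[OF _ measurable_jumps]) fact
qed

lemma measurable_X [measurable (raw)]:
  assumes [measurable]: "g \<in> borel_measurable (borel \<Otimes>\<^sub>M noise_space)"
  shows "(\<lambda>u. X (fst u) i (snd u) (g u)) \<in> borel_measurable (borel \<Otimes>\<^sub>M noise_space)"
proof -
  have [measurable]:
    "(\<lambda>u. c (snd (snd (skeleton (fst u) i (snd u) n)))) \<in> borel_measurable (borel \<Otimes>\<^sub>M noise_space)"
    "(\<lambda>u. fst (snd (skeleton (fst u) i (snd u) n))) \<in> borel_measurable (borel \<Otimes>\<^sub>M noise_space)" for n
    using measurable_skeleton[of i n]
    by (auto intro: measurable_compose[OF measurable_skeleton, where g="\<lambda>v. c (snd (snd v))"]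
        measurable_compose[OF measurable_skeleton, where g="\<lambda>v. fst (snd v)"]
        measurable_compose[OF measurable_snd])
  have "(\<lambda>u. fst (snd (skeleton (fst u) i (snd u) n)) +
      (g u - jump_time (fst u) i (snd u) n) / c (snd (snd (skeleton (fst u) i (snd u) n))))
    \<in> borel_measurable (borel \<Otimes>\<^sub>M noise_space)" for n
    by measurable
  then show ?thesis
    unfolding X_def split_beta by (rule measurable_compose_countable[OF _ measurable_jumps]) fact
qed

lemma jumps_eqI:
  assumes "t < jump_time x i \<omega> (Suc n)" and "\<And>k. k < n \<Longrightarrow> jump_time x i \<omega> (Suc k) \<le> t"
  shows "jumps x i \<omega> t = n"
  unfolding jumps_def
proof (rule Least_equality)
  fix k assume "t < jump_time x i \<omega> (Suc k)"
  then show "n \<le> k"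
    using assms(2)[of k] by (meson not_le)
qed fact

text \<open>Here \<open>LEAST\<close> has no witness. All that matters below is that its unspecified
  value does not depend on \<open>t\<close>.\<close>

lemma jumps_exploded:
  assumes "\<And>n. jump_time x i \<omega> (Suc n) \<le> t"
  shows "jumps x i \<omega> t = (LEAST n. False)"
  unfolding jumps_def using assms by (metis not_le)

lemma jumps_cases:
  obtains n where "t < jump_time x i \<omega> (Suc n)" "\<And>k. k < n \<Longrightarrow> jump_time x i \<omega> (Suc k) \<le> t"
  | "\<And>n. jump_time x i \<omega> (Suc n) \<le> t"
proof (cases "\<exists>n. t < jump_time x i \<omega> (Suc n)")
  case True
  then show thesis
    using that(1)[of "LEAST n. t < jump_time x i \<omega> (Suc n)"]
    by (metis (mono_tags, lifting) LeastI_ex not_less not_less_Least)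
next
  case False
  then show thesis
    using that(2) by (simp add: not_less)
qed

lemma X_mono_same_jumps:
  assumes "s \<le> t" "jumps x i \<omega> s = jumps x i \<omega> t"
  shows "X x i \<omega> s \<le> X x i \<omega> t"
  using assms c_pos[THEN less_imp_le] by (simp add: X_def split_beta divide_right_mono)

text \<open>The count is frozen until the next jump, and forever once the jumps have accumulated.
  The claim covers every path, so no null set enters the measurability proofs.\<close>

lemma jumps_right_constant: "\<exists>e>0. \<forall>s\<in>{t..<t + e}. jumps x i \<omega> s = jumps x i \<omega> t"
proof (cases rule: jumps_cases[of t x i \<omega>])
  case (1 n)
  have "jumps x i \<omega> s = jumps x i \<omega> t" if "s \<in> {t..<jump_time x i \<omega> (Suc n)}" for s
  proof -
    have "jumps x i \<omega> t = n"
      using 1 by (rule jumps_eqI)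
    moreover have "jumps x i \<omega> s = n"
    proof (rule jumps_eqI)
      show "s < jump_time x i \<omega> (Suc n)"
        using that by simp
      show "jump_time x i \<omega> (Suc k) \<le> s" if "k < n" for k
        using 1(2)[OF that] \<open>s \<in> _\<close> by simp
    qed
    ultimately show ?thesis
      by simp
  qed
  then have "\<forall>s\<in>{t..<t + (jump_time x i \<omega> (Suc n) - t)}. jumps x i \<omega> s = jumps x i \<omega> t"
    by (metis add.commute diff_add_cancel)
  then show ?thesis
    using 1(1) by (metis diff_gt_0_iff_gt)
next
  case 2
  have "jumps x i \<omega> s = (LEAST n. False)" if "t \<le> s" for s
    using order_trans[OF 2 that] by (rule jumps_exploded)
  then have "\<forall>s\<in>{t..<t + 1}. jumps x i \<omega> s = jumps x i \<omega> t"
    by (metis atLeastLessThan_iff order_refl)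
  then show ?thesis
    using zero_less_one by blast
qed

text \<open>Once the level is at least \<open>a\<close>, it stays so until the next jump, since it
  rises in between.\<close>

lemma tau_up_eq_INF_rat:
  "tau_up a x i \<omega> =
    (INF q::rat. if 0 \<le> (of_rat q :: real) \<and> a \<le> X x i \<omega> (of_rat q) then ereal (of_rat q) else \<infinity>)"
  unfolding tau_up_def
proof (subst Inf_ereal_eq_INF_rat)
  fix t assume "t \<in> {t. 0 \<le> t \<and> a \<le> X x i \<omega> t}"
  then have t: "0 \<le> t" "a \<le> X x i \<omega> t" by auto
  obtain e where "e > 0" "\<forall>s\<in>{t..<t + e}. jumps x i \<omega> s = jumps x i \<omega> t"
    using jumps_right_constant by blast
  then show "\<exists>e>0. {t..<t + e} \<subseteq> {t. 0 \<le> t \<and> a \<le> X x i \<omega> t}"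
    using t by (intro exI[of _ e]) (auto intro!: order_trans[OF t(2)] X_mono_same_jumps)
qed simp

lemma measurable_tau_up [measurable]:
  "(\<lambda>u. tau_up a (fst u) i (snd u)) \<in> borel_measurable (borel \<Otimes>\<^sub>M noise_space)"
  unfolding tau_up_eq_INF_rat by measurable

text \<open>
  Between jumps the level increases, so it is enough to look for levels below \<open>b\<close> at the jump
  times and, should the jumps accumulate, at their accumulation point.
\<close>

definition down_time :: "real \<Rightarrow> 'e \<Rightarrow> (real \<times> ('e \<Rightarrow> 'e)) stream \<Rightarrow> nat option \<Rightarrow> real" where
  "down_time x i \<omega> k = max 0 (case k of Some n \<Rightarrow> jump_time x i \<omega> n
     | None \<Rightarrow> real_of_ereal (SUP n. ereal (jump_time x i \<omega> (Suc n))))"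

lemma measurable_down_time [measurable]:
  "(\<lambda>u. down_time (fst u) i (snd u) k) \<in> borel_measurable (borel \<Otimes>\<^sub>M noise_space)"
  unfolding down_time_def by (cases k) simp_all

lemma down_time_le:
  assumes "0 \<le> t" "X x i \<omega> t \<le> b"
  shows "\<exists>k. down_time x i \<omega> k \<le> t \<and> X x i \<omega> (down_time x i \<omega> k) \<le> b"
proof (rule jumps_cases[of t x i \<omega>])
  fix n assume n: "t < jump_time x i \<omega> (Suc n)" "\<And>k. k < n \<Longrightarrow> jump_time x i \<omega> (Suc k) \<le> t"
  \<comment> \<open>On an arbitrary path the noise may be negative and jump times unordered, so the
    candidate is the largest of the first \<open>n + 1\<close> rather than the last. It is at most
    \<open>t\<close> and has the same jump count, hence no higher level.\<close>
  define m where "m = Max (down_time x i \<omega> ` Some ` {..n})"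
  have "m \<in> down_time x i \<omega> ` Some ` {..n}"
    unfolding m_def by (rule Max_in) auto
  then obtain k where k: "k \<le> n" "m = down_time x i \<omega> (Some k)"
    by auto
  have m_ge: "down_time x i \<omega> (Some k) \<le> m" if "k \<le> n" for k
    unfolding m_def using that by (intro Max_ge) auto
  have "jump_time x i \<omega> k \<le> t" if "k \<le> n" for k
    using that n(2)[of "k - 1"] assms(1) by (cases k) auto
  then have le: "m \<le> t"
    using k assms(1) by (simp add: down_time_def)
  have "jump_time x i \<omega> (Suc k) \<le> m" if "k < n" for k
    using m_ge[of "Suc k"] that by (simp add: down_time_def)
  then have "jumps x i \<omega> m = n"
    using n le by (intro jumps_eqI) auto
  moreover have "jumps x i \<omega> t = n"
    using n by (rule jumps_eqI)
  ultimately have "X x i \<omega> m \<le> b"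
    using X_mono_same_jumps[OF le, of x i \<omega>] assms(2) by simp
  then show ?thesis
    using k le by auto
next
  assume t: "\<And>n. jump_time x i \<omega> (Suc n) \<le> t"
  \<comment> \<open>From the accumulation point on, \<open>jumps\<close> keeps its default value and
    \<open>X\<close> is a single increasing line, so its lowest level is at the start.\<close>
  define S where "S = (SUP n. ereal (jump_time x i \<omega> (Suc n)))"
  have "S \<le> ereal t"
    unfolding S_def using t by (intro SUP_least) simp
  moreover have S_ge: "ereal (jump_time x i \<omega> (Suc n)) \<le> S" for n
    unfolding S_def by (rule SUP_upper) simp
  ultimately obtain r where r: "S = ereal r"
    using S_ge[of 0] by (cases S) auto
  define m where "m = down_time x i \<omega> None"
  have m: "m = max 0 r"
    by (simp add: m_def down_time_def S_def[symmetric] r)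
  have le: "m \<le> t"
    using m \<open>S \<le> ereal t\<close> r assms(1) by simp
  have "jump_time x i \<omega> (Suc n) \<le> m" for n
    using S_ge[of n] r m by simp
  then have "jumps x i \<omega> m = jumps x i \<omega> t"
    using t by (metis jumps_exploded)
  then have "X x i \<omega> m \<le> b"
    using X_mono_same_jumps[OF le, of x i \<omega>] assms(2) by simp
  then show ?thesis
    using le unfolding m_def by blast
qed

lemma tau_down_eq_INF:
  "tau_down b x i \<omega> =
    (INF k. if X x i \<omega> (down_time x i \<omega> k) \<le> b then ereal (down_time x i \<omega> k) else \<infinity>)"
  (is "_ = ?R")
proof (rule antisym)
  show "tau_down b x i \<omega> \<le> ?R"
  proof (rule INF_greatest)
    fix k
    have "0 \<le> down_time x i \<omega> k"
      by (simp add: down_time_def)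
    then show "tau_down b x i \<omega>
        \<le> (if X x i \<omega> (down_time x i \<omega> k) \<le> b then ereal (down_time x i \<omega> k) else \<infinity>)"
      by (auto simp: tau_down_def intro: Inf_lower)
  qed
  show "?R \<le> tau_down b x i \<omega>"
    unfolding tau_down_def
  proof (rule Inf_greatest, clarify)
    fix t assume "0 \<le> t" "X x i \<omega> t \<le> b"
    then obtain k where k: "down_time x i \<omega> k \<le> t" "X x i \<omega> (down_time x i \<omega> k) \<le> b"
      using down_time_le by blast
    then have "?R \<le> ereal (down_time x i \<omega> k)"
      by (intro INF_lower2[of k]) auto
    then show "?R \<le> ereal t"
      using k(1) by (meson ereal_less_eq(3) order_trans)
  qed
qed

lemma measurable_tau_down [measurable]:
  "(\<lambda>u. tau_down b (fst u) i (snd u)) \<in> borel_measurable (borel \<Otimes>\<^sub>M noise_space)"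
  unfolding tau_down_eq_INF by measurable

section \<open>The discounted passage functional and its decomposition at the first jump\<close>

definition payoff ::
  "real \<Rightarrow> real \<Rightarrow> real \<Rightarrow> 'e \<Rightarrow> real \<Rightarrow> 'e \<Rightarrow> (real \<times> ('e \<Rightarrow> 'e)) stream \<Rightarrow> real" where
  "payoff w b a j x i \<omega> =
    (if tau_up a x i \<omega> < tau_down b x i \<omega> \<and> J x i \<omega> (real_of_ereal (tau_up a x i \<omega>)) = j
     then exp (- w * real_of_ereal (tau_up a x i \<omega>)) else 0)"

lemma measurable_payoff [measurable]:
  "(\<lambda>u. payoff w b a j (fst u) i (snd u)) \<in> borel_measurable (borel \<Otimes>\<^sub>M noise_space)"
  unfolding payoff_def by measurable

lemma tau_up_nonneg: "0 \<le> tau_up a x i \<omega>"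
  unfolding tau_up_def by (rule Inf_greatest) auto

lemma payoff_nonneg: "0 \<le> payoff w b a j x i \<omega>"
  by (simp add: payoff_def)

text \<open>Only the phase at the passage time contributes, and its discount factor is at most
  1.\<close>

lemma sum_payoff_le_1:
  assumes "0 \<le> w"
  shows "(\<Sum>j\<in>UNIV. payoff w b a j x i \<omega>) \<le> 1"
proof (cases "tau_up a x i \<omega> < tau_down b x i \<omega>")
  case True
  have "0 \<le> w * real_of_ereal (tau_up a x i \<omega>)"
    using assms tau_up_nonneg by (simp add: real_of_ereal_pos)
  with True show ?thesis
    by (simp add: payoff_def sum.delta)
qed (simp add: payoff_def)

lemma payoff_le_1: "0 \<le> w \<Longrightarrow> payoff w b a j x i \<omega> \<le> 1"
  using member_le_sum[of j UNIV "\<lambda>j. payoff w b a j x i \<omega>"] sum_payoff_le_1[of w b a x i \<omega>]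
  by (simp add: payoff_nonneg)

text \<open>\<open>skeleton\<close> recurses on the last jump; this form detaches the first one
  instead and restarts from the state after it. It is the Markov property on the level of
  paths.\<close>

lemma skeleton_Stream:
  "skeleton x i ((e, f) ## \<omega>) (Suc n) =
    (case skeleton (p i * (x + e / lam i / c i)) (f i) \<omega> n of (s, y, j) \<Rightarrow> (e / lam i + s, y, j))"
proof (induction n)
  case 0
  show ?case by (simp add: skeleton.simps(2) Let_def)
next
  case (Suc n)
  show ?case
    by (subst skeleton.simps(2), subst Suc)
       (simp add: skeleton.simps(2) Let_def split_beta)
qed

text \<open>A condition on the noise alone, hence usable for all initial states at once. The bound
  ranges over \<open>nat\<close> to keep the quantifier countable.\<close>

definition nonexplosive :: "(real \<times> ('e \<Rightarrow> 'e)) stream \<Rightarrow> bool" where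
  "nonexplosive \<omega> \<longleftrightarrow> (\<forall>n. 0 < fst (\<omega> !! n)) \<and> (\<forall>B::nat. \<exists>n. B < (\<Sum>k<n. fst (\<omega> !! k)))"

text \<open>Each waiting time is at least its noise variable divided by the largest rate, so jump
  times inherit the unboundedness of the partial sums.\<close>

lemma nonexplosive_jump_time:
  assumes "nonexplosive \<omega>"
  obtains n where "t < jump_time x i \<omega> (Suc n)"
proof -
  define M where "M = Max (range lam)"
  have M: "lam j \<le> M" for j
    unfolding M_def by (rule Max_ge) auto
  have M0: "0 < M"
    using M[of i] lam_pos[of i] by simp
  have pos: "0 < fst (\<omega> !! n)" for n
    using assms by (simp add: nonexplosive_def)
  have ge: "(\<Sum>k<n. fst (\<omega> !! k)) / M \<le> jump_time x i \<omega> n" for n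
  proof (induction n)
    case (Suc n)
    have "fst (\<omega> !! n) / M \<le> fst (\<omega> !! n) / lam (snd (snd (skeleton x i \<omega> n)))"
      using pos[of n] M M0 lam_pos by (intro divide_left_mono) (auto intro: less_imp_le)
    with Suc show ?case
      by (simp add: skeleton.simps(2) Let_def split_beta add_divide_distrib)
  qed simp
  obtain B :: nat where "t * M < B"
    using reals_Archimedean2 by blast
  moreover obtain n where "B < (\<Sum>k<n. fst (\<omega> !! k))"
    using assms unfolding nonexplosive_def by blast
  ultimately have n: "t * M < (\<Sum>k<n. fst (\<omega> !! k))"
    by simp
  have "t * M < (\<Sum>k<Suc n. fst (\<omega> !! k))"
    using n pos[of n] by simp
  then have "t < (\<Sum>k<Suc n. fst (\<omega> !! k)) / M"
    using M0 by (simp add: pos_less_divide_eq)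
  also note ge
  finally show thesis
    by (rule that)
qed

context
  fixes x :: real and i :: 'e and e :: real and f :: "'e \<Rightarrow> 'e"
    and \<omega> :: "(real \<times> ('e \<Rightarrow> 'e)) stream" and t y :: real
  assumes t: "t = e / lam i" and y: "y = p i * (x + t / c i)"
begin

lemma jump_time_Stream: "jump_time x i ((e, f) ## \<omega>) (Suc n) = t + jump_time y (f i) \<omega> n"
  unfolding skeleton_Stream by (simp add: split_beta t y)

lemma jumps_Stream_before: "s < t \<Longrightarrow> jumps x i ((e, f) ## \<omega>) s = 0"
  by (rule jumps_eqI) (simp_all add: jump_time_Stream)

lemma X_Stream_before: "s < t \<Longrightarrow> X x i ((e, f) ## \<omega>) s = x + s / c i"
  by (simp add: X_def jumps_Stream_before)

lemma J_Stream_before: "s < t \<Longrightarrow> J x i ((e, f) ## \<omega>) s = i"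
  by (simp add: J_def jumps_Stream_before)

text \<open>Shifting a \<open>LEAST\<close> by one needs a witness, supplied by non-explosion; index
  0 fails because \<open>jump_time y (f i) \<omega> 0\<close> is 0.\<close>

lemma jumps_Stream_after:
  assumes "nonexplosive \<omega>" "t \<le> s"
  shows "jumps x i ((e, f) ## \<omega>) s = Suc (jumps y (f i) \<omega> (s - t))"
proof -
  obtain n where n: "s - t < jump_time y (f i) \<omega> (Suc n)"
    using nonexplosive_jump_time[OF assms(1)] .
  have "jumps x i ((e, f) ## \<omega>) s = (LEAST n. s - t < jump_time y (f i) \<omega> n)"
    unfolding jumps_def jump_time_Stream by (simp add: less_diff_eq algebra_simps)
  also have "\<dots> = Suc (LEAST n. s - t < jump_time y (f i) \<omega> (Suc n))"
    using n assms(2) by (intro Least_Suc) auto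
  finally show ?thesis
    by (simp add: jumps_def)
qed

lemma X_Stream_after:
  assumes "nonexplosive \<omega>" "t \<le> s"
  shows "X x i ((e, f) ## \<omega>) s = X y (f i) \<omega> (s - t)"
  unfolding X_def jumps_Stream_after[OF assms] skeleton_Stream
  by (simp add: split_beta t y algebra_simps)

lemma J_Stream_after:
  assumes "nonexplosive \<omega>" "t \<le> s"
  shows "J x i ((e, f) ## \<omega>) s = J y (f i) \<omega> (s - t)"
  unfolding J_def jumps_Stream_after[OF assms] skeleton_Stream
  by (simp add: split_beta t y)

text \<open>\<open>c i * (a - x)\<close> is the time needed to climb from \<open>x\<close> to
  \<open>a\<close> at slope \<open>1 / c i\<close>. The passage is over before the first jump, so
  the tail of the noise does not enter.\<close>

lemma payoff_Stream_no_jump: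
  assumes "0 < t" "b < x" "x < a" "c i * (a - x) < t"
  shows "payoff w b a j x i ((e, f) ## \<omega>) = (if i = j then exp (- w * (c i * (a - x))) else 0)"
proof -
  define s where "s = c i * (a - x)"
  have s: "0 < s" "s < t"
    using assms c_pos[of i] by (auto simp: s_def)
  have Xs: "X x i ((e, f) ## \<omega>) s = a"
    using s c_pos[of i] by (simp add: X_Stream_before s_def)
  have up: "tau_up a x i ((e, f) ## \<omega>) = ereal s"
    unfolding tau_up_def
  proof (rule antisym)
    show "Inf (ereal ` {t. 0 \<le> t \<and> a \<le> X x i ((e, f) ## \<omega>) t}) \<le> ereal s"
      using s Xs by (intro Inf_lower) auto
    show "ereal s \<le> Inf (ereal ` {t. 0 \<le> t \<and> a \<le> X x i ((e, f) ## \<omega>) t})"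
    proof (rule Inf_greatest, clarsimp)
      fix r assume r: "0 \<le> r" "a \<le> X x i ((e, f) ## \<omega>) r"
      show "s \<le> r"
      proof (rule ccontr)
        assume "\<not> s \<le> r"
        then have "r < s" "r < t" using s by auto
        then show False
          using r c_pos[of i] by (simp add: X_Stream_before s_def field_simps)
      qed
    qed
  qed
  have down: "ereal t \<le> tau_down b x i ((e, f) ## \<omega>)"
    unfolding tau_down_def
  proof (rule Inf_greatest, clarsimp)
    fix r assume r: "0 \<le> r" "X x i ((e, f) ## \<omega>) r \<le> b"
    show "t \<le> r"
    proof (rule ccontr)
      assume "\<not> t \<le> r"
      moreover have "0 \<le> r / c i" using r(1) c_pos[of i] by simp
      ultimately show False
        using r assms(2) by (simp add: X_Stream_before)
    qed
  qed
  have "ereal s < tau_down b x i ((e, f) ## \<omega>)"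
    using s(2) less_le_trans[OF _ down, of "ereal s"] by simp
  then show ?thesis
    unfolding payoff_def up using s(2) by (simp add: J_Stream_before s_def)
qed

text \<open>Before the jump the level stays strictly between \<open>b\<close> and \<open>a\<close>.
  Both passage times are therefore those of the restarted path delayed by \<open>t\<close>, and the
  delay costs the factor \<open>exp (- w * t)\<close>.\<close>

lemma payoff_Stream_jump:
  assumes "0 < t" "b < x" "x < a" "t < c i * (a - x)" and \<omega>: "nonexplosive \<omega>"
  shows "payoff w b a j x i ((e, f) ## \<omega>) = exp (- w * t) * payoff w b a j y (f i) \<omega>"
proof -
  let ?X = "X x i ((e, f) ## \<omega>)" and ?X' = "X y (f i) \<omega>"
  have before: "b < ?X s \<and> ?X s < a" if "0 \<le> s" "s < t" for s
  proof -
    have "0 \<le> s / c i" "s / c i < a - x"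
      using that c_pos[of i] assms(4) by (auto simp: field_simps)
    then show ?thesis
      using that assms by (simp add: X_Stream_before)
  qed
  have shift: "{s. 0 \<le> s \<and> R (?X s)} = (+) t ` {s. 0 \<le> s \<and> R (?X' s)}"
    if "\<And>s. 0 \<le> s \<Longrightarrow> s < t \<Longrightarrow> \<not> R (?X s)" for R
  proof (intro set_eqI iffI)
    fix s assume s: "s \<in> {s. 0 \<le> s \<and> R (?X s)}"
    have "t \<le> s"
      by (rule ccontr) (use s that[of s] in auto)
    then show "s \<in> (+) t ` {s. 0 \<le> s \<and> R (?X' s)}"
      using s by (intro image_eqI[of _ _ "s - t"]) (auto simp: X_Stream_after[OF \<omega>])
  next
    fix s assume "s \<in> (+) t ` {s. 0 \<le> s \<and> R (?X' s)}"
    then show "s \<in> {s. 0 \<le> s \<and> R (?X s)}"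
      using assms(1) by (auto simp: X_Stream_after[OF \<omega>])
  qed
  have up: "tau_up a x i ((e, f) ## \<omega>) = ereal t + tau_up a y (f i) \<omega>"
    unfolding tau_up_def
    by (subst shift[of "\<lambda>v. a \<le> v"]) (use before in \<open>force simp: Inf_ereal_shift\<close>)+
  have down: "tau_down b x i ((e, f) ## \<omega>) = ereal t + tau_down b y (f i) \<omega>"
    unfolding tau_down_def
    by (subst shift[of "\<lambda>v. v \<le> b"]) (use before in \<open>force simp: Inf_ereal_shift\<close>)+
  have less: "tau_up a x i ((e, f) ## \<omega>) < tau_down b x i ((e, f) ## \<omega>)
      \<longleftrightarrow> tau_up a y (f i) \<omega> < tau_down b y (f i) \<omega>"
    unfolding up down
    by (cases "tau_up a y (f i) \<omega>"; cases "tau_down b y (f i) \<omega>") auto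
  show ?thesis
  proof (cases "tau_up a y (f i) \<omega> < tau_down b y (f i) \<omega>")
    case True
    then obtain r where r: "tau_up a y (f i) \<omega> = ereal r" "0 \<le> r"
      using tau_up_nonneg[of a y "f i" \<omega>] by (cases "tau_up a y (f i) \<omega>") auto
    have "tau_up a x i ((e, f) ## \<omega>) = ereal (t + r)"
      using up r by simp
    then show ?thesis
      unfolding payoff_def less using r True
      by (simp add: J_Stream_after[OF \<omega>] exp_add[symmetric] algebra_simps)
  next
    case False
    then show ?thesis
      unfolding payoff_def less by simp
  qed
qed

end

text \<open>The first waiting time is positive, so the path is at \<open>x\<close> at time 0. Then
  \<open>tau_down\<close> is at most 0 and cannot exceed \<open>tau_up\<close>.\<close>

lemma payoff_eq_0:
  assumes "nonexplosive \<omega>" "x \<le> b"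
  shows "payoff w b a j x i \<omega> = 0"
proof -
  have "0 < fst (\<omega> !! 0) / lam i"
    using assms(1) lam_pos[of i] unfolding nonexplosive_def by (intro divide_pos_pos) metis+
  then have "jumps x i \<omega> 0 = 0"
    by (intro jumps_eqI) (auto simp: skeleton.simps(2) Let_def)
  then have "X x i \<omega> 0 = x"
    by (simp add: X_def)
  then have "tau_down b x i \<omega> \<le> 0"
    unfolding tau_down_def using assms(2) by (intro Inf_lower2[of 0]) auto
  then show ?thesis
    using tau_up_nonneg[of a x i \<omega>] by (auto simp: payoff_def)
qed

end

section \<open>The first-step equation\<close>

lemma has_bochner_integral_exponential_density:
  assumes "0 < l"
  shows "has_bochner_integral lborel (\<lambda>u. exponential_density l (u - a)) 1"
proof -
  interpret prob_space "density lborel (exponential_density l)"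
    using assms by (rule prob_space_exponential_density)
  have "has_bochner_integral lborel (exponential_density l) 1"
    using emeasure_space_1 exponential_density_nonneg[OF assms]
    by (intro has_bochner_integral_nn_integral) (auto simp: emeasure_density)
  then show ?thesis
    using lborel_has_bochner_integral_real_affine_iff[of 1 "exponential_density l" 1 "- a"]
    by simp
qed

text \<open>Tilting the density of rate 1 by \<open>exp (- t)\<close> gives half the density of rate
  2.\<close>

lemma nn_integral_exponential_density_exp:
  "(\<integral>\<^sup>+t. ennreal (exponential_density 1 t) * ennreal (exp (- t)) \<partial>lborel) = ennreal (1 / 2)"
proof -
  have "exponential_density 1 t * exp (- t) = exponential_density 2 t / 2" for t :: real
    by (simp add: exponential_density_def exp_add[symmetric])
  then have "(\<integral>\<^sup>+t. ennreal (exponential_density 1 t) * ennreal (exp (- t)) \<partial>lborel) =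
      (\<integral>\<^sup>+t. ennreal (exponential_density 2 t / 2) \<partial>lborel)"
    by (subst ennreal_mult''[symmetric]) (simp_all only: exp_ge_zero)
  also have "\<dots> = ennreal (1 / 2)"
    using has_bochner_integral_exponential_density[of 2 0] exponential_density_nonneg[of 2]
    by (subst nn_integral_eq_integral) (auto simp: has_bochner_integral_iff)
  finally show ?thesis .
qed

section \<open>The law of the noise and almost sure non-explosion\<close>

context growth_collapse
begin

lemma prob_space_jump_noise: "prob_space jump_noise"
proof -
  interpret E: prob_space "density lborel (\<lambda>t. ennreal (exponential_density 1 t))"
    by (rule prob_space_exponential_density) simp
  interpret pair_prob_space "density lborel (\<lambda>t. ennreal (exponential_density 1 t))"
    "measure_pmf (Pi_pmf UNIV undefined phase_law)" ..
  show ?thesis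
    unfolding jump_noise_def by (rule prob_space_axioms)
qed

sublocale jump_noise: prob_space jump_noise
  by (rule prob_space_jump_noise)

sublocale noise: prob_space noise
  unfolding noise_def by (rule jump_noise.prob_space_stream_space)

lemma sets_jump_noise [measurable_cong]: "sets jump_noise = sets (borel \<Otimes>\<^sub>M count_space UNIV)"
  unfolding jump_noise_def by (intro sets_pair_measure_cong) simp_all

lemma sets_noise [measurable_cong]: "sets noise = sets noise_space"
  unfolding noise_def by (rule sets_stream_space_cong) (rule sets_jump_noise)

lemma nn_integral_noise:
  assumes "f \<in> borel_measurable noise_space"
  shows "(\<integral>\<^sup>+\<omega>. f \<omega> \<partial>noise) = (\<integral>\<^sup>+u. (\<integral>\<^sup>+\<omega>. f (u ## \<omega>) \<partial>noise) \<partial>jump_noise)"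
  unfolding noise_def
  using assms measurable_cong_sets[OF sets_noise refl]
  by (intro jump_noise.nn_integral_stream_space) (simp add: noise_def)

lemma nn_integral_jump_noise:
  assumes [measurable]: "f \<in> borel_measurable (borel \<Otimes>\<^sub>M count_space UNIV)"
  shows "(\<integral>\<^sup>+u. f u \<partial>jump_noise) = (\<integral>\<^sup>+e. ennreal (exponential_density 1 e) *
    (\<integral>\<^sup>+g. f (e, g) \<partial>measure_pmf (Pi_pmf UNIV undefined phase_law)) \<partial>lborel)"
proof -
  let ?F = "measure_pmf (Pi_pmf UNIV undefined phase_law)"
  have f: "f \<in> borel_measurable (lborel \<Otimes>\<^sub>M ?F)"
    "f \<in> borel_measurable (density lborel (\<lambda>t. ennreal (exponential_density 1 t)) \<Otimes>\<^sub>M ?F)"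
    by measurable
  have [measurable]: "(\<lambda>e. \<integral>\<^sup>+g. f (e, g) \<partial>?F) \<in> borel_measurable lborel"
    using measure_pmf.borel_measurable_nn_integral_fst[OF f(1)] .
  show ?thesis
    unfolding jump_noise_def measure_pmf.nn_integral_fst[OF f(2), symmetric]
    by (subst nn_integral_density) auto
qed

text \<open>Only the coordinate of the phase being left is read; its marginal is
  \<open>phase_law i\<close>.\<close>

lemma nn_integral_phase:
  "(\<integral>\<^sup>+g. F (g i) \<partial>measure_pmf (Pi_pmf UNIV undefined phase_law)) =
    (\<Sum>h\<in>UNIV. ennreal (Q $ i $ h) * F h)"
proof -
  have "(\<integral>\<^sup>+g. F (g i) \<partial>measure_pmf (Pi_pmf UNIV undefined phase_law)) =
      (\<integral>\<^sup>+h. F h \<partial>measure_pmf (map_pmf (\<lambda>g. g i) (Pi_pmf UNIV undefined phase_law)))"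
    by simp
  also have "map_pmf (\<lambda>g. g i) (Pi_pmf UNIV undefined phase_law) = phase_law i"
    by (subst Pi_pmf_component) simp_all
  finally show ?thesis
    by (simp add: nn_integral_measure_pmf nn_integral_count_space_finite pmf_phase_law)
qed

lemma AE_jump_noise_pos: "AE u in jump_noise. 0 < fst u"
proof -
  have "(\<integral>\<^sup>+u. indicator {u. \<not> 0 < fst u} u \<partial>jump_noise) =
    (\<integral>\<^sup>+e. ennreal (exponential_density 1 e) *
      (\<integral>\<^sup>+g. indicator {u. \<not> 0 < fst u} (e, g) \<partial>measure_pmf (Pi_pmf UNIV undefined phase_law)) \<partial>lborel)"
    by (rule nn_integral_jump_noise) measurable
  also have "\<dots> = (\<integral>\<^sup>+e. 0 \<partial>(lborel :: real measure))"
    using AE_lborel_singleton[of 0]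
    by (intro nn_integral_cong_AE, eventually_elim) (auto simp: exponential_density_def indicator_def)
  finally show ?thesis
    by (subst AE_iff_nn_integral) simp_all
qed

lemma measurable_nonexplosive [measurable]: "Measurable.pred noise_space nonexplosive"
  unfolding nonexplosive_def by measurable

lemma nn_integral_exp_sum_noise:
  "(\<integral>\<^sup>+\<omega>. ennreal (exp (- (\<Sum>k<n. fst (\<omega> !! k)))) \<partial>noise) = ennreal ((1 / 2) ^ n)"
proof (induction n)
  case 0
  show ?case by (simp add: noise.emeasure_space_1)
next
  case (Suc n)
  have "(\<integral>\<^sup>+\<omega>. ennreal (exp (- (\<Sum>k<Suc n. fst (\<omega> !! k)))) \<partial>noise) =
    (\<integral>\<^sup>+u. (\<integral>\<^sup>+\<omega>. ennreal (exp (- fst u)) * ennreal (exp (- (\<Sum>k<n. fst (\<omega> !! k)))) \<partial>noise) \<partial>jump_noise)"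
    by (subst nn_integral_noise, measurable)
       (simp add: sum.lessThan_Suc_shift exp_add[symmetric] exp_diff ennreal_mult[symmetric] exp_minus divide_inverse mult.commute del: sum.lessThan_Suc)
  also have "\<dots> = (\<integral>\<^sup>+u. ennreal (exp (- fst u)) * ennreal ((1 / 2) ^ n) \<partial>jump_noise)"
    by (subst nn_integral_cmult) (simp_all add: Suc)
  also have "\<dots> = (\<integral>\<^sup>+u. ennreal (exp (- fst u)) \<partial>jump_noise) * ennreal ((1 / 2) ^ n)"
    by (rule nn_integral_multc) measurable
  also have "(\<integral>\<^sup>+u. ennreal (exp (- fst u)) \<partial>jump_noise) = ennreal (1 / 2)"
    by (subst nn_integral_jump_noise)
       (simp_all add: measure_pmf.emeasure_space_1 nn_integral_exponential_density_exp)
  also have "ennreal (1 / 2) * ennreal ((1 / 2) ^ n) = ennreal ((1 / 2) ^ Suc n)"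
    by (subst ennreal_mult[symmetric]) simp_all
  finally show ?case .
qed

text \<open>The infimum of \<open>exp (- S_n)\<close> over \<open>n\<close> has integral at most
  \<open>(1 / 2) ^ n\<close> for each \<open>n\<close>, so it vanishes almost surely. A bound on the
  partial sums would keep it positive.\<close>

lemma AE_nonexplosive: "AE \<omega> in noise. nonexplosive \<omega>"
proof -
  let ?S = "\<lambda>\<omega> n. \<Sum>k<n. fst (\<omega> !! k :: real \<times> ('e \<Rightarrow> 'e))"
  let ?f = "\<lambda>\<omega>. INF n. ennreal (exp (- ?S \<omega> n))"
  have [measurable]: "?f \<in> borel_measurable noise"
    by measurable
  have "(\<integral>\<^sup>+\<omega>. ?f \<omega> \<partial>noise) \<le> ennreal ((1 / 2) ^ n)" for n
    unfolding nn_integral_exp_sum_noise[symmetric] by (intro nn_integral_mono INF_lower) simp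
  moreover have "(\<lambda>n. ennreal ((1 / 2) ^ n)) \<longlonglongrightarrow> ennreal 0"
    by (intro tendsto_ennrealI LIMSEQ_power_zero) simp
  ultimately have "(\<integral>\<^sup>+\<omega>. ?f \<omega> \<partial>noise) = 0"
    using LIMSEQ_le_const[of "\<lambda>n. ennreal ((1 / 2) ^ n)" "ennreal 0"] by fastforce
  then have "AE \<omega> in noise. ?f \<omega> = 0"
    by (subst (asm) nn_integral_0_iff_AE) simp_all
  moreover have "AE \<omega> in noise. stream_all (\<lambda>u. 0 < fst u) \<omega>"
    unfolding noise_def by (rule jump_noise.AE_stream_all[OF _ AE_jump_noise_pos]) measurable
  ultimately show ?thesis
  proof eventually_elim
    case (elim \<omega>)
    have "\<exists>n. real B < ?S \<omega> n" for B
    proof (rule ccontr)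
      assume "\<not> ?thesis"
      then have "ennreal (exp (- real B)) \<le> ?f \<omega>"
        by (intro INF_greatest ennreal_leI) (simp add: not_less)
      then show False
        using elim(1) by simp
    qed
    then show ?case
      using elim(2) by (simp add: nonexplosive_def stream_all_def)
  qed
qed

section \<open>The transform as an integral, and conditioning on the first jump\<close>

text \<open>The entry of \<open>Zup\<close> with its integral formula used at all levels, without
  the conventions for \<open>x \<le> b\<close> and \<open>a \<le> x\<close>.\<close>

definition passage :: "real \<Rightarrow> real \<Rightarrow> real \<Rightarrow> 'e \<Rightarrow> real \<Rightarrow> 'e \<Rightarrow> real" where
  "passage w b a j x i = (\<integral>\<omega>. payoff w b a j x i \<omega> \<partial>noise)"

lemma measurable_payoff_noise [measurable]: "payoff w b a j x i \<in> borel_measurable noise_space"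
  using measurable_compose[OF measurable_Pair1'[of x borel noise_space] measurable_payoff[of w b a j i]]
  by simp

lemma measurable_passage [measurable]: "(\<lambda>x. passage w b a j x i) \<in> borel_measurable borel"
  unfolding passage_def
  by (rule noise.borel_measurable_lebesgue_integral)
     (use measurable_payoff[of w b a j i] in \<open>simp add: split_beta cong: measurable_cong_sets\<close>)

lemma integrable_payoff:
  assumes "0 \<le> w"
  shows "integrable noise (payoff w b a j x i)"
  by (rule noise.integrable_const_bound[where B=1])
     (use assms in \<open>simp_all add: payoff_nonneg payoff_le_1 cong: measurable_cong_sets\<close>)

lemma passage_nonneg: "0 \<le> passage w b a j x i"
  unfolding passage_def by (simp add: payoff_nonneg)

lemma sum_passage_le_1:
  assumes "0 \<le> w"
  shows "(\<Sum>j\<in>UNIV. passage w b a j x i) \<le> 1"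
proof -
  have "(\<Sum>j\<in>UNIV. passage w b a j x i) = (\<integral>\<omega>. (\<Sum>j\<in>UNIV. payoff w b a j x i \<omega>) \<partial>noise)"
    unfolding passage_def using assms by (simp add: integrable_payoff)
  also have "\<dots> \<le> (\<integral>\<omega>. 1 \<partial>noise)"
    using assms by (intro integral_mono) (simp_all add: integrable_payoff sum_payoff_le_1)
  finally show ?thesis
    by (simp add: noise.prob_space)
qed

lemma passage_le_1: "0 \<le> w \<Longrightarrow> passage w b a j x i \<le> 1"
  using member_le_sum[of j UNIV "\<lambda>j. passage w b a j x i"] sum_passage_le_1[of w b a x i]
  by (simp add: passage_nonneg)

lemma nn_integral_payoff:
  assumes "0 \<le> w"
  shows "(\<integral>\<^sup>+\<omega>. ennreal (payoff w b a j x i \<omega>) \<partial>noise) = ennreal (passage w b a j x i)"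
  unfolding passage_def using assms
  by (intro nn_integral_eq_integral) (simp_all add: integrable_payoff payoff_nonneg)

lemma passage_eq_0:
  assumes "x \<le> b"
  shows "passage w b a j x i = 0"
  unfolding passage_def
  by (rule integral_eq_zero_AE) (use AE_nonexplosive assms in \<open>auto simp: payoff_eq_0\<close>)

text \<open>At or below \<open>b\<close> the integral vanishes too, in agreement with the convention
  of \<open>Zup\<close>.\<close>

lemma Zup_eq_passage:
  assumes "x < a"
  shows "Zup w b x a $ i $ j = passage w b a j x i"
proof (cases "x \<le> b")
  case True
  then show ?thesis
    by (simp add: Zup_def passage_eq_0)
next
  case False
  with assms show ?thesis
    by (simp add: Zup_def passage_def payoff_def)
qed

text \<open>Here \<open>u\<close> is the level just before the jump.\<close>

definition after_jump :: "real \<Rightarrow> real \<Rightarrow> real \<Rightarrow> 'e \<Rightarrow> 'e \<Rightarrow> real \<Rightarrow> real" where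
  "after_jump w b a j i u = (\<Sum>h\<in>UNIV. Q $ i $ h * passage w b a j (p i * u) h)"

lemma measurable_after_jump [measurable]: "after_jump w b a j i \<in> borel_measurable borel"
  unfolding after_jump_def by measurable

lemma after_jump_nonneg: "0 \<le> after_jump w b a j i u"
  unfolding after_jump_def by (intro sum_nonneg mult_nonneg_nonneg Q_nonneg passage_nonneg)

lemma after_jump_le_1:
  assumes "0 \<le> w"
  shows "after_jump w b a j i u \<le> 1"
proof -
  have "after_jump w b a j i u \<le> (\<Sum>h\<in>UNIV. Q $ i $ h * 1)"
    unfolding after_jump_def
    using assms by (intro sum_mono mult_left_mono Q_nonneg passage_le_1)
  then show ?thesis
    by (simp add: Q_row_sum)
qed

text \<open>For \<open>u \<ge> x\<close>: the density of the level at which the first jump occurs,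
  times the discount \<open>exp (- w * c i * (u - x))\<close> for the time taken to climb
  there.\<close>

definition jump_density :: "real \<Rightarrow> 'e \<Rightarrow> real \<Rightarrow> real \<Rightarrow> real" where
  "jump_density w i x u = c i * lam i * exp (- (u - x) * z w i)"

lemma measurable_jump_density [measurable]: "jump_density w i x \<in> borel_measurable borel"
  unfolding jump_density_def by measurable

lemma jump_density_nonneg: "0 \<le> jump_density w i x u"
  using c_pos[of i] lam_pos[of i] by (simp add: jump_density_def)

lemma z_pos: "0 \<le> w \<Longrightarrow> 0 < z w i"
  using c_pos[of i] lam_pos[of i] by (simp add: z_def)

lemma set_integrable_jump_density:
  fixes f :: "real \<Rightarrow> real"
  assumes "0 \<le> w" "f \<in> borel_measurable borel" "\<And>u. \<bar>f u\<bar> \<le> B"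
  shows "set_integrable lborel {l..r} (\<lambda>u. jump_density w i x u * f u)"
proof -
  have B: "0 \<le> B"
    using assms(3)[of 0] by simp
  have "\<bar>jump_density w i x u * f u\<bar> \<le> jump_density w i x l * B" if "l \<le> u" for u
  proof -
    have "jump_density w i x u \<le> jump_density w i x l"
      using that z_pos[OF assms(1), of i] c_pos[of i] lam_pos[of i] unfolding jump_density_def
      by (intro mult_left_mono) (auto intro!: mult_right_mono)
    then show ?thesis
      using assms(3)[of u] jump_density_nonneg[of w i x] B by (simp add: abs_mult mult_mono)
  qed
  then show ?thesis
    unfolding set_integrable_def using assms(2)
    by (intro integrableI_bounded_set_indicator[where B="jump_density w i x l * B"])
       (auto simp: emeasure_lborel_Icc_eq)
qed

lemma first_step:
  assumes w: "0 \<le> w" and "b < x" "x < a"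
  shows "passage w b a j x i = (if i = j then exp (- (a - x) * z w i) else 0) +
    (LBINT u:{x..a}. jump_density w i x u * after_jump w b a j i u)"
proof -
  let ?E = "exponential_density 1 :: real \<Rightarrow> real"
  let ?F = "measure_pmf (Pi_pmf UNIV undefined phase_law)"
  define D0 where "D0 = (if i = j then exp (- w * (c i * (a - x))) else 0 :: real)"
  \<comment> \<open>\<open>G e\<close> is the mean payoff given that the first exponential variable
    is \<open>e\<close>. The tie between jump and passage falls in the second branch, but has
    probability 0.\<close>
  define G where "G e = (if c i * (a - x) < e / lam i then D0
    else exp (- w * (e / lam i)) * after_jump w b a j i (x + e / lam i / c i))" for e
  have D0: "0 \<le> D0" by (simp add: D0_def)
  have G: "0 \<le> G e" for e
    by (simp add: G_def D0 after_jump_nonneg)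
  have [measurable]: "G \<in> borel_measurable borel"
    unfolding G_def by measurable
  have inner: "(\<integral>\<^sup>+g. (\<integral>\<^sup>+\<omega>. ennreal (payoff w b a j x i ((e, g) ## \<omega>)) \<partial>noise) \<partial>?F) = ennreal (G e)"
    if e: "0 < e" "e \<noteq> lam i * (c i * (a - x))" for e
  proof -
    have t: "0 < e / lam i" "e / lam i \<noteq> c i * (a - x)"
      using e lam_pos[of i] by (auto simp: field_simps)
    show ?thesis
    proof (cases "c i * (a - x) < e / lam i")
      case True
      then have "payoff w b a j x i ((e, g) ## \<omega>) = D0" for g \<omega>
        using payoff_Stream_no_jump[OF refl refl t(1), of b x a] assms by (simp add: D0_def)
      then show ?thesis
        using True by (simp add: G_def noise.emeasure_space_1 measure_pmf.emeasure_space_1)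
    next
      case False
      then have less: "e / lam i < c i * (a - x)"
        using t by simp
      define y where "y = p i * (x + e / lam i / c i)"
      have "(\<integral>\<^sup>+\<omega>. ennreal (payoff w b a j x i ((e, g) ## \<omega>)) \<partial>noise) =
          ennreal (exp (- w * (e / lam i))) * ennreal (passage w b a j y (g i))" for g
      proof -
        have "AE \<omega> in noise. ennreal (payoff w b a j x i ((e, g) ## \<omega>)) =
            ennreal (exp (- w * (e / lam i))) * ennreal (payoff w b a j y (g i) \<omega>)"
          using AE_nonexplosive
        proof eventually_elim
          case (elim \<omega>)
          show ?case
            using payoff_Stream_jump[OF refl y_def t(1) assms(2,3) less elim, of w j g]
            by (simp add: ennreal_mult payoff_nonneg)
        qed
        then have "(\<integral>\<^sup>+\<omega>. ennreal (payoff w b a j x i ((e, g) ## \<omega>)) \<partial>noise) =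
          (\<integral>\<^sup>+\<omega>. ennreal (exp (- w * (e / lam i))) * ennreal (payoff w b a j y (g i) \<omega>) \<partial>noise)"
          by (rule nn_integral_cong_AE)
        also have "\<dots> = ennreal (exp (- w * (e / lam i))) * ennreal (passage w b a j y (g i))"
          using w by (subst nn_integral_cmult) (simp_all add: nn_integral_payoff)
        finally show ?thesis .
      qed
      then have "(\<integral>\<^sup>+g. (\<integral>\<^sup>+\<omega>. ennreal (payoff w b a j x i ((e, g) ## \<omega>)) \<partial>noise) \<partial>?F) =
          (\<integral>\<^sup>+g. ennreal (exp (- w * (e / lam i))) * ennreal (passage w b a j y (g i)) \<partial>?F)"
        by simp
      also have "\<dots> = (\<Sum>h\<in>UNIV. ennreal (Q $ i $ h) *
          (ennreal (exp (- w * (e / lam i))) * ennreal (passage w b a j y h)))"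
        by (rule nn_integral_phase)
      also have "\<dots> = ennreal (G e)"
        using False
        by (simp add: G_def after_jump_def y_def sum_distrib_left ennreal_mult[symmetric] passage_nonneg
            Q_nonneg sum_ennreal mult_ac)
      finally show ?thesis .
    qed
  qed
  have "ennreal (passage w b a j x i) = (\<integral>\<^sup>+\<omega>. ennreal (payoff w b a j x i \<omega>) \<partial>noise)"
    using w by (simp add: nn_integral_payoff)
  also have "\<dots> = (\<integral>\<^sup>+u. (\<integral>\<^sup>+\<omega>. ennreal (payoff w b a j x i (u ## \<omega>)) \<partial>noise) \<partial>jump_noise)"
    by (rule nn_integral_noise) measurable
  also have "\<dots> = (\<integral>\<^sup>+e. ennreal (?E e) *
      (\<integral>\<^sup>+g. (\<integral>\<^sup>+\<omega>. ennreal (payoff w b a j x i ((e, g) ## \<omega>)) \<partial>noise) \<partial>?F) \<partial>lborel)"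
    by (rule nn_integral_jump_noise) measurable
  also have "\<dots> = (\<integral>\<^sup>+e. ennreal (?E e * G e) \<partial>lborel)"
  proof (rule nn_integral_cong_AE)
    show "AE e in lborel. ennreal (?E e) *
        (\<integral>\<^sup>+g. (\<integral>\<^sup>+\<omega>. ennreal (payoff w b a j x i ((e, g) ## \<omega>)) \<partial>noise) \<partial>?F) = ennreal (?E e * G e)"
      using AE_lborel_singleton[of 0] AE_lborel_singleton[of "lam i * (c i * (a - x))"]
    proof eventually_elim
      case (elim e)
      show ?case
      proof (cases "0 < e")
        case True
        then show ?thesis
          using elim G exponential_density_nonneg[of 1 e] by (simp add: inner ennreal_mult)
      next
        case False
        then show ?thesis
          using elim by (simp add: exponential_density_def)
      qed
    qed
  qed
  \<comment> \<open>All conditioning took place in \<open>ennreal\<close>, where Tonelli applies at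
    once; from here on the integrals are real.\<close>
  finally have "passage w b a j x i = enn2real (\<integral>\<^sup>+e. ennreal (?E e * G e) \<partial>lborel)"
    by (metis enn2real_ennreal passage_nonneg)
  also have "\<dots> = (\<integral>e. ?E e * G e \<partial>lborel)"
    using G exponential_density_nonneg[of 1] by (intro integral_eq_nn_integral[symmetric]) auto
  \<comment> \<open>Substitution of \<open>u = x + e / (lam i * c i)\<close>, the level the linear
    climb reaches when the first waiting time ends.\<close>
  also have "\<dots> = \<bar>lam i * c i\<bar> *\<^sub>R (\<integral>u. ?E (- lam i * c i * x + lam i * c i * u) *
      G (- lam i * c i * x + lam i * c i * u) \<partial>lborel)"
    using c_pos[of i] lam_pos[of i] by (intro lborel_integral_real_affine) simp
  \<comment> \<open>Beyond \<open>a\<close>, memorylessness turns the density started at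
    \<open>x\<close> into one started at \<open>a\<close> times the probability of no jump before
    \<open>a\<close>. That probability and the discount combine to
    \<open>exp (- (a - x) * z w i)\<close>, and the restarted density has mass 1.\<close>
  also have "\<dots> = (\<integral>u. exponential_density (lam i * c i) (u - a) * (if i = j then exp (- (a - x) * z w i) else 0)
      + indicator {x..a} u *\<^sub>R (jump_density w i x u * after_jump w b a j i u) \<partial>lborel)"
    unfolding real_scaleR_def integral_mult_right_zero[symmetric]
  proof (rule integral_cong_AE)
    show "AE u in lborel. \<bar>lam i * c i\<bar> * (?E (- lam i * c i * x + lam i * c i * u) *
        G (- lam i * c i * x + lam i * c i * u)) =
      exponential_density (lam i * c i) (u - a) * (if i = j then exp (- (a - x) * z w i) else 0)
      + indicator {x..a} u * (jump_density w i x u * after_jump w b a j i u)"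
      using AE_lborel_singleton[of a]
    proof eventually_elim
      case (elim u)
      define e where "e = - lam i * c i * x + lam i * c i * u"
      have lc: "0 < lam i * c i" "0 < lam i" "0 < c i"
        using c_pos[of i] lam_pos[of i] by simp_all
      have e: "e = lam i * c i * (u - x)"
        by (simp add: e_def algebra_simps)
      have t: "e / lam i = c i * (u - x)"
        using lc by (simp add: e)
      have u: "x + e / lam i / c i = u"
        using lc by (simp add: t)
      let ?r = "exponential_density (lam i * c i) (u - a) * (if i = j then exp (- (a - x) * z w i) else 0)
        + indicator {x..a} u * (jump_density w i x u * after_jump w b a j i u)"
      consider "u < x" | "x \<le> u" "u < a" | "a < u"
        using elim by linarith
      then show ?case
        unfolding e_def[symmetric]
      proof cases
        case 1
        then have "e < 0"
          using lc by (simp add: e mult_pos_neg)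
        then show "\<bar>lam i * c i\<bar> * (?E e * G e) = ?r"
          using 1 assms by (simp add: exponential_density_def)
      next
        case 2
        have "0 \<le> e"
          using lc 2 by (simp add: e)
        moreover have "G e = exp (- w * (c i * (u - x))) * after_jump w b a j i u"
          using 2 lc unfolding G_def u unfolding t by simp
        ultimately show "\<bar>lam i * c i\<bar> * (?E e * G e) = ?r"
          using 2 lc by (simp add: exponential_density_def jump_density_def z_def e exp_add[symmetric] algebra_simps)
      next
        case 3
        have "0 \<le> e"
          using lc 3 assms by (simp add: e)
        moreover have "G e = D0"
          using 3 lc unfolding G_def t by simp
        ultimately show "\<bar>lam i * c i\<bar> * (?E e * G e) = ?r"
          using 3 lc by (simp add: exponential_density_def D0_def z_def e exp_add[symmetric] algebra_simps)
      qed
    qed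
  qed simp_all
  also have "\<dots> = (if i = j then exp (- (a - x) * z w i) else 0) +
      (LBINT u:{x..a}. jump_density w i x u * after_jump w b a j i u)"
  proof -
    have "has_bochner_integral lborel (\<lambda>u. exponential_density (lam i * c i) (u - a)) 1"
      using c_pos[of i] lam_pos[of i] by (intro has_bochner_integral_exponential_density) simp
    moreover have "set_integrable lborel {x..a} (\<lambda>u. jump_density w i x u * after_jump w b a j i u)"
      using w after_jump_le_1[OF w] after_jump_nonneg
      by (intro set_integrable_jump_density[where B=1]) auto
    ultimately show ?thesis
      unfolding set_lebesgue_integral_def set_integrable_def
      by (subst Bochner_Integration.integral_add) (auto simp: has_bochner_integral_iff)
  qed
  finally show ?thesis .
qed

end

section \<open>Extension from \<open>a\<close> to \<open>a / pbar\<close>\<close>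

lemma set_integral_sum:
  fixes f :: "'i \<Rightarrow> 'a \<Rightarrow> 'b::{banach, second_countable_topology}"
  assumes "\<And>i. i \<in> I \<Longrightarrow> set_integrable M A (f i)"
  shows "set_integrable M A (\<lambda>x. \<Sum>i\<in>I. f i x)"
    and "(LINT x:A|M. (\<Sum>i\<in>I. f i x)) = (\<Sum>i\<in>I. LINT x:A|M. f i x)"
  using assms unfolding set_integrable_def set_lebesgue_integral_def
  by (simp_all add: scaleR_sum_right)

lemma matrix_diff_rdistrib:
  fixes A B :: "'a::ring_1 ^ 'n ^ 'm"
  shows "(A - B) ** C = A ** C - B ** C"
  by (simp add: vec_eq_iff matrix_matrix_mult_def left_diff_distrib sum_subtractf)

lemma matrix_inv_left:
  fixes A :: "'a::semiring_1 ^ 'n ^ 'n"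
  assumes "invertible A"
  shows "matrix_inv A ** A = mat 1"
  using someI_ex[OF assms[unfolded invertible_def]] unfolding matrix_inv_def by blast

text \<open>A kernel vector satisfies \<open>v = P *v v\<close>. At an index where \<bar>v\<bar>
  attains its maximum \<open>M\<close>, this bounds \<open>M\<close> by a row sum below 1 times
  \<open>M\<close>, so \<open>M\<close> cannot be positive.\<close>

lemma invertible_mat_1_minus:
  fixes P :: "real ^ 'n ^ 'n"
  assumes "\<And>i. (\<Sum>j\<in>UNIV. \<bar>P $ i $ j\<bar>) < 1"
  shows "invertible (mat 1 - P)"
proof -
  have "v = 0" if v: "(mat 1 - P) *v v = 0" for v
  proof -
    have "v = P *v v"
      using v by (simp add: matrix_vector_mult_diff_rdistrib)
    then have v_eq: "v $ i = (\<Sum>j\<in>UNIV. P $ i $ j * v $ j)" for i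
      by (metis (no_types) matrix_vector_mult_def vec_lambda_beta)
    define M where "M = Max (range (\<lambda>i. \<bar>v $ i\<bar>))"
    have le: "\<bar>v $ j\<bar> \<le> M" for j
      unfolding M_def by (rule Max_ge) auto
    have "M \<in> range (\<lambda>i. \<bar>v $ i\<bar>)"
      unfolding M_def by (rule Max_in) auto
    then obtain i where i: "\<bar>v $ i\<bar> = M"
      by auto
    have "M \<le> (\<Sum>j\<in>UNIV. \<bar>P $ i $ j * v $ j\<bar>)"
      unfolding i[symmetric] by (subst v_eq) (rule sum_abs)
    also have "\<dots> \<le> (\<Sum>j\<in>UNIV. \<bar>P $ i $ j\<bar>) * M"
      unfolding sum_distrib_right abs_mult by (intro sum_mono mult_left_mono le) simp
    finally have "\<not> 0 < M"
      using assms[of i] mult_strict_right_mono[of _ 1 M] by fastforce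
    then have "v $ j = 0" for j
      using le[of j] by simp
    then show "v = 0"
      by (simp add: vec_eq_iff)
  qed
  then show ?thesis
    unfolding invertible_left_inverse matrix_left_invertible_ker by blast
qed

section \<open>Contraction and factorisation over the level \<open>a\<close>\<close>

context growth_collapse
begin

text \<open>On \<open>u \<ge> x\<close> the jump density is \<open>lam i / (lam i + w)\<close> times
  the exponential density of rate \<open>z w i\<close> started at \<open>x\<close>, so this ratio
  bounds its mass.\<close>

lemma abs_set_integral_jump_density_le:
  assumes w: "0 \<le> w" and B: "0 \<le> B" "\<And>u. x \<le> u \<Longrightarrow> u \<le> a \<Longrightarrow> \<bar>f u\<bar> \<le> B"
  shows "\<bar>LBINT u:{x..a}. jump_density w i x u * f u\<bar> \<le> lam i / (lam i + w) * B"
proof -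
  let ?d = "\<lambda>u. lam i / (lam i + w) * B * exponential_density (z w i) (u - x)"
  have lam: "0 < lam i + w" "0 < lam i"
    using w lam_pos[of i] by simp_all
  have d: "has_bochner_integral lborel (\<lambda>u. exponential_density (z w i) (u - x)) 1"
    by (rule has_bochner_integral_exponential_density[OF z_pos[OF w]])
  have jd: "jump_density w i x u = lam i / (lam i + w) * exponential_density (z w i) (u - x)" if "x \<le> u" for u
    using that lam by (simp add: jump_density_def exponential_density_def z_def)
  have "\<bar>LBINT u:{x..a}. jump_density w i x u * f u\<bar>
      \<le> (\<integral>u. \<bar>indicator {x..a} u * (jump_density w i x u * f u)\<bar> \<partial>lborel)"
    unfolding set_lebesgue_integral_def real_scaleR_def by (rule integral_abs_bound)
  also have "\<dots> \<le> (\<integral>u. ?d u \<partial>lborel)"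
  proof (rule integral_mono')
    show "integrable lborel ?d"
      using d by (simp add: has_bochner_integral_iff)
    fix u
    have "0 \<le> exponential_density (z w i) (u - x)"
      by (rule exponential_density_nonneg[OF z_pos[OF w]])
    then show "0 \<le> ?d u"
      using B lam by simp
    then show "\<bar>indicator {x..a} u * (jump_density w i x u * f u)\<bar> \<le> ?d u"
    proof (cases "u \<in> {x..a}")
      case True
      then have "jump_density w i x u * \<bar>f u\<bar> \<le> jump_density w i x u * B"
        using B by (intro mult_left_mono jump_density_nonneg) auto
      moreover have "?d u = jump_density w i x u * B"
        using True by (simp add: jd mult_ac)
      ultimately show ?thesis
        using True jump_density_nonneg[of w i x u] by (simp add: abs_mult)
    qed simp
  qed
  also have "\<dots> = lam i / (lam i + w) * B"
    using d by (simp add: has_bochner_integral_iff)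
  finally show ?thesis .
qed

lemma set_integrable_after_jump:
  assumes "0 \<le> w"
  shows "set_integrable lborel {l..r} (\<lambda>u. jump_density w i x u * after_jump w b a j i u)"
  using assms after_jump_le_1[OF assms] after_jump_nonneg
  by (intro set_integrable_jump_density[where B=1]) auto

text \<open>The first-step equation with target \<open>A\<close>, cut at \<open>a\<close>. Past
  \<open>a\<close>, the jump density from \<open>x\<close> is \<open>exp (- (a - x) * z w i)\<close>
  times the one from \<open>a\<close>, so that portion and the no-jump term reassemble into the
  equation at \<open>a\<close>.\<close>

lemma passage_split:
  assumes w: "0 \<le> w" and less: "b < x" "x < a" "a < A"
  shows "passage w b A j x i = exp (- (a - x) * z w i) * passage w b A j a i
    + (LBINT u:{x..a}. jump_density w i x u * after_jump w b A j i u)"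
proof -
  let ?f = "\<lambda>u. jump_density w i x u * after_jump w b A j i u"
  have shift: "jump_density w i x u = exp (- (a - x) * z w i) * jump_density w i a u" for u
    by (simp add: jump_density_def exp_add[symmetric] algebra_simps)
  have "{x..A} = {x..a} \<union> {a..A}"
    using less by auto
  then have "(LBINT u:{x..A}. ?f u) = (LBINT u:{x..a}. ?f u) + (LBINT u:{a..A}. ?f u)"
    using AE_lborel_singleton[of a]
    by (simp add: set_integral_Un_AE set_integrable_after_jump[OF w] eventually_mono)
  also have "(LBINT u:{a..A}. ?f u) = exp (- (a - x) * z w i) *
      (LBINT u:{a..A}. jump_density w i a u * after_jump w b A j i u)"
    unfolding shift by (simp add: mult.assoc)
  finally show ?thesis
    using first_step[of w b x A j i] first_step[of w b a A j i] less w
    by (simp add: algebra_simps exp_add[symmetric])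
qed

text \<open>
  Both sides solve the first-step equation below \<open>a\<close>, which is a contraction because of
  the discounting.
\<close>

lemma passage_factor:
  assumes w: "0 < w" and b: "0 \<le> b" "b < a" "a < A" and "y < a"
  shows "passage w b A j y h = (\<Sum>k\<in>UNIV. passage w b a k y h * passage w b A j a k)"
proof -
  define \<Delta> where
    "\<Delta> y h = passage w b A j y h - (\<Sum>k\<in>UNIV. passage w b a k y h * passage w b A j a k)" for y h
  \<comment> \<open>The contraction factor: the largest discounted jump mass over the finitely many
    phases, below 1 as \<open>w\<close> is positive.\<close>
  define \<rho> where "\<rho> = Max (range (\<lambda>i. lam i / (lam i + w)))"
  have w0: "0 \<le> w" using w by simp
  have \<rho>_ge: "lam i / (lam i + w) \<le> \<rho>" for i
    unfolding \<rho>_def by (rule Max_ge) auto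
  have "\<rho> \<in> range (\<lambda>i. lam i / (lam i + w))"
    unfolding \<rho>_def by (rule Max_in) auto
  then have \<rho>: "0 \<le> \<rho>" "\<rho> < 1"
    using lam_pos w by (auto simp: less_imp_le add_pos_pos)
  \<comment> \<open>Each use of the first-step equation gains a factor \<open>\<rho>\<close>,
    uniformly in level and phase. The base case holds because both terms of \<open>\<Delta>\<close>
    lie between 0 and 1.\<close>
  have bound: "\<bar>\<Delta> y h\<bar> \<le> \<rho> ^ n" if "y < a" for n y h
    using that
  proof (induction n arbitrary: y h)
    case 0
    have "(\<Sum>k\<in>UNIV. passage w b a k y h * passage w b A j a k) \<le> (\<Sum>k\<in>UNIV. passage w b a k y h * 1)"
      using w0 by (intro sum_mono mult_left_mono passage_nonneg passage_le_1)
    also have "\<dots> \<le> 1"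
      using w0 by (simp add: sum_passage_le_1)
    finally have "(\<Sum>k\<in>UNIV. passage w b a k y h * passage w b A j a k) \<le> 1" .
    moreover have "0 \<le> (\<Sum>k\<in>UNIV. passage w b a k y h * passage w b A j a k)"
      by (intro sum_nonneg mult_nonneg_nonneg passage_nonneg)
    ultimately show ?case
      using passage_nonneg[of w b A j y h] passage_le_1[OF w0, of b A j y h]
      unfolding \<Delta>_def by simp
  next
    case (Suc n)
    show ?case
    proof (cases "y \<le> b")
      case True
      then show ?thesis
        using \<rho> by (simp add: \<Delta>_def passage_eq_0)
    next
      case False
      then have y: "b < y" by simp
      let ?jd = "jump_density w h y"
      have "(\<Sum>k\<in>UNIV. passage w b a k y h * passage w b A j a k) =
          (\<Sum>k\<in>UNIV. (if h = k then exp (- (a - y) * z w h) * passage w b A j a k else 0))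
          + (\<Sum>k\<in>UNIV. (LBINT u:{y..a}. ?jd u * after_jump w b a k h u) * passage w b A j a k)"
        unfolding first_step[OF w0 y Suc.prems] sum.distrib[symmetric]
        by (intro sum.cong) (auto simp: algebra_simps)
      also have "(\<Sum>k\<in>UNIV. (LBINT u:{y..a}. ?jd u * after_jump w b a k h u) * passage w b A j a k) =
          (LBINT u:{y..a}. (\<Sum>k\<in>UNIV. ?jd u * after_jump w b a k h u * passage w b A j a k))"
        using set_integrable_after_jump[OF w0]
        by (subst set_integral_sum(2)) auto
      \<comment> \<open>The terms for reaching \<open>a\<close> without a jump are the same on both
        sides and cancel, leaving only the jump integrals.\<close>
      finally have "\<Delta> y h = (LBINT u:{y..a}. ?jd u * after_jump w b A j h u) -
          (LBINT u:{y..a}. (\<Sum>k\<in>UNIV. ?jd u * after_jump w b a k h u * passage w b A j a k))"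
        unfolding \<Delta>_def by (subst passage_split[OF w0 y Suc.prems b(3)]) simp
      also have "\<dots> = (LBINT u:{y..a}. ?jd u * after_jump w b A j h u -
          (\<Sum>k\<in>UNIV. ?jd u * after_jump w b a k h u * passage w b A j a k))"
        using set_integrable_after_jump[OF w0]
        by (subst set_integral_diff) (auto intro!: set_integral_sum(1))
      also have "\<dots> = (LBINT u:{y..a}. ?jd u * (\<Sum>l\<in>UNIV. Q $ h $ l * \<Delta> (p h * u) l))"
      proof -
        have "?jd u * after_jump w b A j h u -
            (\<Sum>k\<in>UNIV. ?jd u * after_jump w b a k h u * passage w b A j a k) =
          ?jd u * (\<Sum>l\<in>UNIV. Q $ h $ l * \<Delta> (p h * u) l)" for u
        proof -
          have "(\<Sum>k\<in>UNIV. after_jump w b a k h u * passage w b A j a k) =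
              (\<Sum>l\<in>UNIV. Q $ h $ l * (\<Sum>k\<in>UNIV. passage w b a k (p h * u) l * passage w b A j a k))"
            unfolding after_jump_def sum_distrib_left sum_distrib_right
            by (subst sum.swap) (simp add: mult_ac)
          then show ?thesis
            by (simp add: \<Delta>_def after_jump_def right_diff_distrib sum_subtractf sum_distrib_left[symmetric]
                mult.assoc)
        qed
        then show ?thesis by simp
      qed
      finally have "\<bar>\<Delta> y h\<bar> \<le> lam h / (lam h + w) * \<rho> ^ n"
      proof (simp only:, intro abs_set_integral_jump_density_le w0)
        show "0 \<le> \<rho> ^ n" using \<rho> by simp
        fix u assume u: "y \<le> u" "u \<le> a"
        \<comment> \<open>\<open>u\<close> is positive because \<open>0 \<le> b < y \<le> u\<close>.
          Even a jump from \<open>u = a\<close> thus lands strictly below \<open>a\<close>, where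
          the induction hypothesis applies.\<close>
        have "p h * u < u"
          using u y b(1) p_less_1[of h] by simp
        then have "p h * u < a" using u by simp
        then have "\<bar>\<Sum>l\<in>UNIV. Q $ h $ l * \<Delta> (p h * u) l\<bar> \<le> (\<Sum>l\<in>UNIV. Q $ h $ l * \<rho> ^ n)"
          by (intro order_trans[OF sum_abs] sum_mono)
             (simp add: abs_mult Q_nonneg mult_left_mono Suc.IH)
        then show "\<bar>\<Sum>l\<in>UNIV. Q $ h $ l * \<Delta> (p h * u) l\<bar> \<le> \<rho> ^ n"
          by (simp add: sum_distrib_right[symmetric] Q_row_sum)
      qed
      also have "\<dots> \<le> \<rho> * \<rho> ^ n"
        using \<rho> \<rho>_ge by (intro mult_right_mono) auto
      finally show ?thesis by simp
    qed
  qed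
  have "\<bar>\<Delta> y h\<bar> \<le> 0"
  proof (rule LIMSEQ_le_const)
    show "(\<lambda>n. \<rho> ^ n) \<longlonglongrightarrow> 0"
      using \<rho> by (intro LIMSEQ_power_zero) simp
  qed (use bound[OF assms(5)] in auto)
  then show ?thesis
    by (simp add: \<Delta>_def)
qed

lemma Zup_factor:
  assumes "0 < w" "0 \<le> b" "b < a" "a < A" "y < a"
  shows "Zup w b y A = Zup w b y a ** Zup w b a A"
  using passage_factor[OF assms] assms
  by (simp add: vec_eq_iff matrix_matrix_mult_def Zup_eq_passage)

section \<open>Jumps from below \<open>a / pbar\<close> and the matrix \<open>P\<close>\<close>

lemma pbar_ge: "p i \<le> pbar"
  unfolding pbar_def by (rule Max_ge) auto

lemma pbar_pos: "0 < pbar"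
  using p_pos pbar_ge by (rule less_le_trans)

lemma pbar_less_1: "pbar < 1"
proof -
  have "pbar \<in> range p"
    unfolding pbar_def by (rule Max_in) auto
  then show ?thesis
    using p_less_1 by auto
qed

lemma less_div_pbar: "0 < a \<Longrightarrow> a < a / pbar"
  using pbar_pos pbar_less_1 by (simp add: field_simps)

text \<open>This accounts for the level \<open>a / pbar\<close>: it is the largest one from below
  which jumps in every phase land below \<open>a\<close>.\<close>

lemma jump_below:
  assumes "0 < a" "u < a / pbar"
  shows "p i * u < a"
proof (cases "0 < u")
  case True
  have "p i * u \<le> pbar * u"
    using True pbar_ge by simp
  also have "\<dots> < a"
    using assms pbar_pos by (simp add: field_simps)
  finally show ?thesis .
next
  case False
  then have "p i * u \<le> 0"
    using p_pos[of i] by (simp add: mult_nonneg_nonpos)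
  then show ?thesis
    using assms(1) by simp
qed

text \<open>The substitution \<open>y = p i * u\<close> passes from the level after the jump to the
  level before it; the prefactors then combine to the jump density.\<close>

lemma P_nth:
  "P w a K x $ i $ j =
    (LBINT u:{x..a / pbar}. jump_density w i x u * (\<Sum>h\<in>UNIV. Q $ i $ h * K (p i * u) $ h $ j))"
proof -
  let ?f = "\<lambda>y. (\<Sum>h\<in>UNIV. Q $ i $ h * K y $ h $ j)"
  have "(LBINT y:{p i * x .. p i * a / pbar}. ?f y * exp (- (z w i / p i) * y)) =
      p i * (\<integral>u. indicator {p i * x .. p i * a / pbar} (p i * u) *
        (?f (p i * u) * exp (- (z w i / p i) * (p i * u))) \<partial>lborel)"
    unfolding set_lebesgue_integral_def
    using lborel_integral_real_affine[of "p i" "\<lambda>y. indicator {p i * x .. p i * a / pbar} y *\<^sub>R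
        (?f y * exp (- (z w i / p i) * y))" 0] p_pos[of i]
    by simp
  then have "P w a K x $ i $ j = (\<integral>u. gam i * exp (z w i * x) * p i *
      (indicator {p i * x .. p i * a / pbar} (p i * u) *
        (?f (p i * u) * exp (- (z w i / p i) * (p i * u)))) \<partial>lborel)"
    by (simp add: P_def)
  also have "\<dots> = (LBINT u:{x..a / pbar}. jump_density w i x u * ?f (p i * u))"
    unfolding set_lebesgue_integral_def
  proof (intro Bochner_Integration.integral_cong refl)
    fix u
    have "indicator {p i * x .. p i * a / pbar} (p i * u) = (indicator {x..a / pbar} u :: real)"
      using p_pos[of i] pbar_pos by (simp add: indicator_def field_simps)
    moreover have "gam i * exp (z w i * x) * p i * exp (- (z w i / p i) * (p i * u)) = jump_density w i x u"
      using p_pos[of i] by (simp add: gam_def jump_density_def exp_add[symmetric] algebra_simps)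
    ultimately show "gam i * exp (z w i * x) * p i *
      (indicator {p i * x .. p i * a / pbar} (p i * u) *
        (?f (p i * u) * exp (- (z w i / p i) * (p i * u)))) =
      indicator {x..a / pbar} u *\<^sub>R (jump_density w i x u * ?f (p i * u))"
      by (simp add: mult_ac)
  qed
  finally show ?thesis .
qed

text \<open>\<open>K\<close> is known only below \<open>a\<close>, and \<open>p i * u\<close> can
  equal \<open>a\<close> only at the endpoint \<open>u = a / pbar\<close>, a null set.\<close>

lemma P_eq_after_jump:
  assumes a: "0 < a" and K: "\<And>y. y < a \<Longrightarrow> K y = Zup w b y a"
  shows "P w a K x $ i $ j = (LBINT u:{x..a / pbar}. jump_density w i x u * after_jump w b a j i u)"
proof -
  let ?L = "\<lambda>u. indicator {x..a / pbar} u * (jump_density w i x u * (\<Sum>h\<in>UNIV. Q $ i $ h * K (p i * u) $ h $ j))"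
  let ?R = "\<lambda>u. indicator {x..a / pbar} u * (jump_density w i x u * after_jump w b a j i u)"
  have eq: "?L u = ?R u" if "u \<noteq> a / pbar" for u
  proof (cases "u < a / pbar")
    case True
    then have "p i * u < a"
      using a by (intro jump_below)
    then show ?thesis
      by (simp add: after_jump_def K Zup_eq_passage)
  next
    case False
    then show ?thesis
      using that by simp
  qed
  \<comment> \<open>\<open>K\<close> itself carries no measurability; the integrand does, being a
    measurable function altered at one point.\<close>
  have "?L = (\<lambda>u. if u = a / pbar then ?L (a / pbar) else ?R u)"
    using eq by auto
  also have "\<dots> \<in> borel_measurable lborel"
    by measurable
  finally have "(\<integral>u. ?L u \<partial>lborel) = (\<integral>u. ?R u \<partial>lborel)"
    using AE_lborel_singleton[of "a / pbar"] eq by (intro integral_cong_AE) auto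
  then show ?thesis
    unfolding P_nth set_lebesgue_integral_def by simp
qed

section \<open>The linear equation for the transform and its solution\<close>

lemma sum_P_less_1:
  assumes w: "0 < w" and a: "0 < a" and K: "\<And>y. y < a \<Longrightarrow> K y = Zup w b y a"
  shows "(\<Sum>j\<in>UNIV. \<bar>P w a K x $ i $ j\<bar>) < 1"
proof -
  have w0: "0 \<le> w" using w by simp
  have "0 \<le> P w a K x $ i $ j" for j
    unfolding P_eq_after_jump[OF a K, simplified] set_lebesgue_integral_def
    by (intro integral_nonneg_AE) (simp add: jump_density_nonneg after_jump_nonneg)
  then have "(\<Sum>j\<in>UNIV. \<bar>P w a K x $ i $ j\<bar>) =
      (\<Sum>j\<in>UNIV. LBINT u:{x..a / pbar}. jump_density w i x u * after_jump w b a j i u)"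
    using P_eq_after_jump[OF a K] by simp
  also have "\<dots> = (LBINT u:{x..a / pbar}. jump_density w i x u * (\<Sum>j\<in>UNIV. after_jump w b a j i u))"
    unfolding sum_distrib_left
    using set_integrable_after_jump[OF w0] by (subst set_integral_sum(2)) auto
  also have "\<dots> \<le> \<bar>LBINT u:{x..a / pbar}. jump_density w i x u * (\<Sum>j\<in>UNIV. after_jump w b a j i u)\<bar>"
    by simp
  also have "\<dots> \<le> lam i / (lam i + w) * 1"
  proof (rule abs_set_integral_jump_density_le[OF w0])
    fix u
    have "(\<Sum>j\<in>UNIV. after_jump w b a j i u) =
        (\<Sum>h\<in>UNIV. Q $ i $ h * (\<Sum>j\<in>UNIV. passage w b a j (p i * u) h))"
      unfolding after_jump_def sum_distrib_left by (rule sum.swap)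
    also have "\<dots> \<le> (\<Sum>h\<in>UNIV. Q $ i $ h * 1)"
      using w0 by (intro sum_mono mult_left_mono Q_nonneg sum_passage_le_1)
    finally show "\<bar>\<Sum>j\<in>UNIV. after_jump w b a j i u\<bar> \<le> 1"
      by (simp add: Q_row_sum sum_nonneg after_jump_nonneg)
  qed simp
  also have "\<dots> < 1"
    using w lam_pos[of i] by simp
  finally show ?thesis .
qed

text \<open>In the first-step equation with target \<open>a / pbar\<close>, almost every jump lands
  below \<open>a\<close>, so the factorisation applies under the integral. The factor for the
  passage from \<open>a\<close> is constant in \<open>u\<close> and comes out as a matrix
  product.\<close>

lemma Zup_above:
  assumes w: "0 < w" and b: "0 \<le> b" "b < a" and x: "a \<le> x" "x < a / pbar"
    and K: "\<And>y. y < a \<Longrightarrow> K y = Zup w b y a"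
  shows "Zup w b x (a / pbar) = D w a x + P w a K x ** Zup w b a (a / pbar)"
proof -
  have a: "0 < a" and w0: "0 \<le> w" using b w by simp_all
  let ?A = "a / pbar"
  have "passage w b ?A j x i = D w a x $ i $ j +
      (\<Sum>k\<in>UNIV. P w a K x $ i $ k * passage w b ?A j a k)" for i j
  proof -
    let ?R = "\<lambda>u. \<Sum>k\<in>UNIV. jump_density w i x u * after_jump w b a k i u * passage w b ?A j a k"
    have "(LBINT u:{x..?A}. jump_density w i x u * after_jump w b ?A j i u) = (LBINT u:{x..?A}. ?R u)"
      unfolding set_lebesgue_integral_def
    proof (rule integral_cong_AE)
      show "AE u in lborel. indicator {x..?A} u *\<^sub>R (jump_density w i x u * after_jump w b ?A j i u) =
          indicator {x..?A} u *\<^sub>R ?R u"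
        using AE_lborel_singleton[of ?A]
      proof eventually_elim
        case (elim u)
        show ?case
        proof (cases "u < ?A")
          case True
          then have "p i * u < a"
            using a by (intro jump_below)
          then have "after_jump w b ?A j i u =
              (\<Sum>h\<in>UNIV. \<Sum>k\<in>UNIV. Q $ i $ h * passage w b a k (p i * u) h * passage w b ?A j a k)"
            using passage_factor[OF w b less_div_pbar[OF a]]
            by (simp add: after_jump_def sum_distrib_left mult.assoc)
          also have "\<dots> = (\<Sum>k\<in>UNIV. after_jump w b a k i u * passage w b ?A j a k)"
            unfolding after_jump_def sum_distrib_right by (rule sum.swap)
          finally show ?thesis
            by (simp add: sum_distrib_left mult.assoc)
        next
          case False
          with elim show ?thesis by simp
        qed
      qed
    qed simp_all
    also have "\<dots> = (\<Sum>k\<in>UNIV. P w a K x $ i $ k * passage w b ?A j a k)"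
      unfolding P_eq_after_jump[OF a K, simplified]
      using set_integrable_after_jump[OF w0] by (subst set_integral_sum(2)) auto
    finally show ?thesis
      using first_step[of w b x ?A j i] w0 b x by (simp add: D_def)
  qed
  then show ?thesis
    using x less_div_pbar[OF a] by (simp add: vec_eq_iff matrix_matrix_mult_def Zup_eq_passage)
qed

lemma invertible_mat_1_minus_P:
  assumes "0 < w" "0 < a" "\<And>y. y < a \<Longrightarrow> K y = Zup w b y a"
  shows "invertible (mat 1 - P w a K a)"
  using sum_P_less_1[OF assms] by (intro invertible_mat_1_minus)

text \<open>At \<open>x = a\<close> the formula of \<open>Zup_above\<close> has the unknown on both
  sides and is solved for it.\<close>

lemma Zup_at:
  assumes w: "0 < w" and b: "0 \<le> b" "b < a" and K: "\<And>y. y < a \<Longrightarrow> K y = Zup w b y a"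
  shows "Zup w b a (a / pbar) = matrix_inv (mat 1 - P w a K a) ** D w a a"
proof -
  have a: "0 < a" using b by simp
  let ?Z = "Zup w b a (a / pbar)" and ?I = "mat 1 - P w a K a"
  have "?Z = D w a a + P w a K a ** ?Z"
    using less_div_pbar[OF a] by (intro Zup_above assms) simp_all
  then have "?I ** ?Z = D w a a"
    by (simp add: matrix_diff_rdistrib algebra_simps)
  then have "matrix_inv ?I ** D w a a = (matrix_inv ?I ** ?I) ** ?Z"
    by (simp flip: matrix_mul_assoc)
  also have "matrix_inv ?I ** ?I = mat 1"
    using invertible_mat_1_minus_P[OF w a K] by (rule matrix_inv_left)
  finally show ?thesis
    by simp
qed

text \<open>The two branches of \<open>extend\<close> are the factorisation over \<open>a\<close>
  and \<open>Zup_above\<close>; \<open>Zup_at\<close> identifies \<open>R\<close> with the transform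
  started at \<open>a\<close>.\<close>

lemma Zup_eq_extend:
  assumes "0 < w" "0 \<le> b" "b < a" and K: "\<And>y. y < a \<Longrightarrow> K y = Zup w b y a" and "x < a / pbar"
  shows "Zup w b x (a / pbar) = extend w a K x"
proof -
  have "extend w a K x = (if x < a then K x ** Zup w b a (a / pbar)
      else D w a x + P w a K x ** Zup w b a (a / pbar))"
    unfolding extend_def Let_def using Zup_at[OF assms(1-4)] by simp
  then show ?thesis
    using Zup_factor[of w b a "a / pbar" x] Zup_above[of w b a x K] less_div_pbar[of a] assms
    by auto
qed

end

text \<open>The last conjunct expresses the determination claim: \<open>extend\<close> sees the
  transform only through \<open>K\<close>, and any \<open>K\<close> that agrees with it below
  \<open>a\<close> gives the same result.\<close>

theorem theorem5p3:
  fixes c lam p :: "'e::finite \<Rightarrow> real" and Q :: "real ^ 'e ^ 'e" and w a b :: real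
  assumes "growth_collapse c lam p Q"
    and "0 < w" and "0 \<le> b" and "b < a"
  shows "let Z = growth_collapse.Zup c lam p Q w b;
             pbar = growth_collapse.pbar p;
             D = growth_collapse.D c lam p w a;
             P = growth_collapse.P c lam p Q w a (\<lambda>y. Z y a)
         in (\<forall>x\<in>{a..<a / pbar}. Z x (a / pbar) = D x + P x ** Z a (a / pbar))
          \<and> invertible (mat 1 - P a)
          \<and> Z a (a / pbar) = matrix_inv (mat 1 - P a) ** D a
          \<and> (\<forall>K. (\<forall>y<a. K y = Z y a) \<longrightarrow>
                (\<forall>x<a / pbar. Z x (a / pbar) = growth_collapse.extend c lam p Q w a K x))"
proof -
  interpret growth_collapse c lam p Q by fact
  show ?thesis
    unfolding Let_def using assms(2-4)
    by (auto intro!: Zup_above Zup_at Zup_eq_extend invertible_mat_1_minus_P[where b=b])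
qed

end
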